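(* Let $(g_N)_{N\in\mathbb{N}}$ be a sequence of positive reals such that $g_N$ and $N/g_N$ are both monotonically increasing and both diverge to $\infty$ as $N\to\infty$. Then for every $\varepsilon>0$ there exist a sequence of positive integers $(n_k)_{k\ge1}$ satisfying the Hadamard gap condition (i.e. $n_{k+1}/n_k\ge q$ for all $k$, for some $q>1$), a mean zero trigonometric polynomial $f$, and an infinite set $\mathcal{N}\subseteq\mathbb{N}$ such that for all $a,b\in\mathbb{N}$ there is a constant $C_{a,b}$ with $L(N,a,b)\le C_{a,b}\,N/g_N$ for all $N\in\mathcal{N}$, and such that $$\limsup_{N\to\infty,\ N\in\mathcal{N}}\ \frac{\mathbb{P}\left[S_N\ge (1+\varepsilon)\|f\|_2\sqrt{2N\log g_N}\right]}{1-\Phi\!\left((1+\varepsilon)\sqrt{2\log g_N}\right)}=\infty .$$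
   Context: A mean zero trigonometric polynomial is a function $f(x)=\sum_{j=1}^d \left(c_j\cos(2\pi jx)+s_j\sin(2\pi jx)\right)$ with real coefficients. $\|f\|_2=\left(\int_0^1 f(x)^2\,dx\right)^{1/2}$. The probability $\mathbb{P}$ is Lebesgue measure on $[0,1]$, and $S_N(x)=\sum_{k=1}^N f(n_kx)$. $\Phi$ is the standard normal distribution function. For $a,b\in\mathbb{N}$, $L(N,a,b):=\sup_{c\in\mathbb{Z}}\#\{(k,\ell): 1\le k,\ell\le N,\ a n_k-b n_\ell=c\}$, where in the case $a=b$ the supremum is taken only over $c\neq0$. *)

theory Defs
  imports "HOL-Probability.Probability"
begin

(* Sequences (n_k), k >= 1, are functions on nat whose value at 0 is never used. *)

definition mean_zero_trig_poly :: "(real \<Rightarrow> real) \<Rightarrow> bool" where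
  "mean_zero_trig_poly f \<longleftrightarrow>
    (\<exists>(d::nat) (c::nat \<Rightarrow> real) (s::nat \<Rightarrow> real). \<forall>x.
      f x = (\<Sum>j=1..d. c j * cos (2 * pi * real j * x) + s j * sin (2 * pi * real j * x)))"

definition L2_norm_unit :: "(real \<Rightarrow> real) \<Rightarrow> real" where
  "L2_norm_unit f = sqrt (LINT x:{0..1}|lborel. (f x)\<^sup>2)"

definition hadamard_gap :: "(nat \<Rightarrow> nat) \<Rightarrow> bool" where
  "hadamard_gap n \<longleftrightarrow> (\<exists>q>1. \<forall>k\<ge>1. real (n (Suc k)) / real (n k) \<ge> q)"

definition lac_sum :: "(real \<Rightarrow> real) \<Rightarrow> (nat \<Rightarrow> nat) \<Rightarrow> nat \<Rightarrow> real \<Rightarrow> real" where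
  "lac_sum f n N x = (\<Sum>k=1..N. f (real (n k) * x))"

(* The cardinalities are at most N^2, so this supremum in nat is a genuine one. *)
definition dioph_L :: "(nat \<Rightarrow> nat) \<Rightarrow> nat \<Rightarrow> nat \<Rightarrow> nat \<Rightarrow> nat" where
  "dioph_L n N a b =
    (SUP c \<in> {c::int. a = b \<longrightarrow> c \<noteq> 0}.
      card {(k, l). k \<in> {1..N} \<and> l \<in> {1..N} \<and> int a * int (n k) - int b * int (n l) = c})"

definition std_normal_cdf :: "real \<Rightarrow> real" where
  "std_normal_cdf = cdf std_normal_distribution"

end

theory Submission
  imports Defs
begin

text \<open>
  Take \<open>f x = (\<Sum>j<K. cos (2 \<pi> 3\<^sup>j x))\<close> with \<open>K\<close> large and, up to a sparse choice of stages
  \<open>P < k \<le> N\<close>, put \<open>n\<^sub>k = D 3\<^sup>k + \<lfloor>k / M\<rfloor>\<close> with \<open>M \<approx> N / g\<^sub>N\<close> and \<open>D\<close> a huge multiple of \<open>g\<^sub>N\<close>.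
  The shifts \<open>\<lfloor>k / M\<rfloor>\<close> confine the solutions of \<open>a n\<^sub>k - b n\<^sub>l = c\<close> with \<open>a 3\<^sup>k = b 3\<^sup>l\<close> to a
  single block of length \<open>M\<close>, hence \<open>L(N, a, b) = O(N / g\<^sub>N)\<close>. On \<open>[0, 1 / G]\<close>, where \<open>G\<close> is a constant
  times \<open>g\<^sub>N\<close>, the shifts only contribute phases below \<open>\<pi> / 3\<close>, so there \<open>S\<^sub>N\<close> behaves like
  \<open>K (\<Sum>k. cos (2 \<pi> D 3\<^sup>k x))\<close>, whose variance exceeds \<open>N \<parallel>f\<parallel>\<^sup>2\<close> by a factor of order \<open>K\<close>. Its tail
  is bounded below by tilting Lebesgue measure with the Riesz product \<open>\<Prod>k. 1 + a cos (2 \<pi> 3\<^sup>k y)\<close>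
  and Chebyshev's inequality. The result is a probability of at least \<open>c g\<^sub>N\<^sup>-\<^sup>1 g\<^sub>N\<^sup>-\<^sup>\<epsilon>\<close>, much larger
  than the Gaussian \<open>g\<^sub>N\<close> to the power \<open>-(1 + \<epsilon>)\<^sup>2\<close>.
\<close>

section \<open>Riesz products with frequencies powers of three\<close>

definition riesz :: "real \<Rightarrow> nat set \<Rightarrow> real \<Rightarrow> real" where
  "riesz a E y = (\<Prod>e\<in>E. 1 + a * cos (2 * pi * 3 ^ e * y))"

text \<open>The phase lets one real quantity carry both the cosine and the sine coefficient at
  \<open>w\<close>; \<open>w\<close> is an integer because the recursion over \<open>E\<close>
  shifts it in both directions.\<close>

definition riesz_coeff :: "real \<Rightarrow> nat set \<Rightarrow> int \<Rightarrow> real \<Rightarrow> real" where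
  "riesz_coeff a E w \<phi> = integral {0..1} (\<lambda>y. riesz a E y * cos (2 * pi * of_int w * y + \<phi>))"

lemma continuous_on_riesz [continuous_intros]: "continuous_on S (riesz a E)"
  unfolding riesz_def by (intro continuous_intros)

lemma integral_cos_int:
  "integral {0..1} (\<lambda>y. cos (2 * pi * of_int w * y + \<phi>)) = (if w = 0 then cos \<phi> else 0)"
proof (cases "w = 0")
  case False
  define F where "F = (\<lambda>y. sin (2 * pi * of_int w * y + \<phi>) / (2 * pi * of_int w))"
  have "((\<lambda>y. cos (2 * pi * of_int w * y + \<phi>)) has_integral (F 1 - F 0)) {0..1}"
  proof (rule fundamental_theorem_of_calculus)
    show "(F has_vector_derivative cos (2 * pi * of_int w * x + \<phi>)) (at x within {0..1})" for x
      using False unfolding F_def has_real_derivative_iff_has_vector_derivative[symmetric]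
      by (auto intro!: derivative_eq_intros)
  qed simp
  moreover have "F 1 = F 0"
    by (simp add: F_def sin_add sin_int_2pin cos_int_2pin)
  ultimately show ?thesis using False by (auto dest: integral_unique)
qed simp

lemma riesz_coeff_empty: "riesz_coeff a {} w \<phi> = (if w = 0 then cos \<phi> else 0)"
  by (simp add: riesz_coeff_def riesz_def integral_cos_int)

text \<open>Product-to-sum: a new factor couples the frequency \<open>w\<close> with
  \<open>w + 3 ^ m\<close> and \<open>w - 3 ^ m\<close>. The coefficients below are computed by this
  recursion, peeling off the largest exponent.\<close>

lemma riesz_coeff_insert:
  assumes "finite E" "m \<notin> E"
  shows "riesz_coeff a (insert m E) w \<phi> =
    riesz_coeff a E w \<phi> + a / 2 * (riesz_coeff a E (w + 3 ^ m) \<phi> + riesz_coeff a E (w - 3 ^ m) \<phi>)"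
proof -
  have "riesz a (insert m E) y * cos (2 * pi * of_int w * y + \<phi>) =
      riesz a E y * cos (2 * pi * of_int w * y + \<phi>)
      + a / 2 * (riesz a E y * cos (2 * pi * of_int (w + 3 ^ m) * y + \<phi>)
        + riesz a E y * cos (2 * pi * of_int (w - 3 ^ m) * y + \<phi>))" for y
  proof -
    let ?u = "2 * pi * of_int w * y + \<phi>" and ?v = "2 * pi * 3 ^ m * y"
    have "2 * pi * of_int (w + 3 ^ m) * y + \<phi> = ?u + ?v"
      "2 * pi * of_int (w - 3 ^ m) * y + \<phi> = ?u - ?v"
      by (simp_all add: algebra_simps)
    moreover have "riesz a (insert m E) y = (1 + a * cos ?v) * riesz a E y"
      using assms by (simp add: riesz_def)
    ultimately show ?thesis
      by (simp only: cos_add[of ?u ?v] cos_diff[of ?u ?v]) (simp add: algebra_simps)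
  qed
  then show ?thesis
    unfolding riesz_coeff_def
    by (simp add: integral_add integrable_continuous_real continuous_intros)
qed

lemma riesz_coeff_uminus: "riesz_coeff a E (- w) \<phi> = riesz_coeff a E w (- \<phi>)"
proof -
  have "cos (2 * pi * of_int (- w) * y + \<phi>) = cos (2 * pi * of_int w * y + - \<phi>)" for y
    using cos_minus[of "2 * pi * of_int w * y + - \<phi>"] by simp
  then show ?thesis by (simp only: riesz_coeff_def)
qed

text \<open>The frequencies of the product are signed sums of distinct powers \<open>3 ^ e\<close>
  with \<open>e < m\<close>, hence below \<open>3 ^ m / 2\<close> in absolute value. In the
  induction all three terms of the recursion stay out of range.\<close>

lemma riesz_coeff_eq_0:
  assumes "finite E" "\<And>e. e \<in> E \<Longrightarrow> e < m" "3 ^ m \<le> 2 * \<bar>w\<bar>"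
  shows "riesz_coeff a E w \<phi> = 0"
  using assms
proof (induction E arbitrary: m w rule: finite_linorder_max_induct)
  case empty
  moreover have "(0::int) < 3 ^ m" by simp
  ultimately have "w \<noteq> 0" by linarith
  then show ?case by (simp add: riesz_coeff_empty)
next
  case (insert b E)
  have "(3::int) ^ Suc b \<le> 3 ^ m"
    using insert.prems(1) by (intro power_increasing) (auto simp: Suc_le_eq)
  then have "3 * (3::int) ^ b \<le> 2 * \<bar>w\<bar>" using insert.prems by simp
  moreover have "(0::int) < 3 ^ b" by simp
  ultimately have *: "3 ^ b \<le> 2 * \<bar>w\<bar>" "3 ^ b \<le> 2 * \<bar>w + 3 ^ b\<bar>" "3 ^ b \<le> 2 * \<bar>w - 3 ^ b\<bar>"
    by (smt (verit))+
  have "b \<notin> E" using insert.hyps by auto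
  with * insert.hyps show ?case
    by (simp add: riesz_coeff_insert insert.IH[of b])
qed

lemma riesz_coeff_0:
  assumes "finite E"
  shows "riesz_coeff a E 0 \<phi> = cos \<phi>"
  using assms
proof (induction E rule: finite_linorder_max_induct)
  case empty
  then show ?case by (simp add: riesz_coeff_empty)
next
  case (insert b E)
  have "b \<notin> E" using insert.hyps by auto
  with insert show ?case
    by (simp add: riesz_coeff_insert riesz_coeff_eq_0[of E b])
qed

lemma power3_step: "e < m \<Longrightarrow> 3 * (3::int) ^ e \<le> 3 ^ m"
  using power_increasing[of "Suc e" m "3::int"] by simp

lemma riesz_coeff_single:
  assumes "finite E"
  shows "riesz_coeff a E (3 ^ e) \<phi> = (if e \<in> E then a / 2 * cos \<phi> else 0)"
  using assms
proof (induction E rule: finite_linorder_max_induct)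
  case empty
  then show ?case by (simp add: riesz_coeff_empty)
next
  case (insert b E)
  have b: "b \<notin> E" using insert.hyps by auto
  have pos: "(0::int) < 3 ^ b" "(0::int) < 3 ^ e" by simp_all
  have z: "riesz_coeff a E w \<phi> = 0" if "3 ^ b \<le> 2 * \<bar>w\<bar>" for w
    using insert.hyps that by (intro riesz_coeff_eq_0[of E b]) auto
  consider "e < b" | "e = b" | "b < e" by linarith
  then show ?case
  proof cases
    case 1
    with power3_step[of e b] pos
    have "3 ^ b \<le> 2 * \<bar>3 ^ e + 3 ^ b :: int\<bar>" "3 ^ b \<le> 2 * \<bar>3 ^ e - 3 ^ b :: int\<bar>"
      by (smt (verit))+
    note zs = this[THEN z]
    with 1 b insert zs show ?thesis by (simp add: riesz_coeff_insert)
  next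
    case 2
    have "3 ^ b \<le> 2 * \<bar>3 ^ e + 3 ^ b :: int\<bar>" "3 ^ b \<le> 2 * \<bar>3 ^ e :: int\<bar>"
      using 2 by simp_all
    note zs = this[THEN z]
    with 2 b insert zs show ?thesis by (simp add: riesz_coeff_insert riesz_coeff_0)
  next
    case 3
    with power3_step[of b e] pos
    have "3 ^ b \<le> 2 * \<bar>3 ^ e + 3 ^ b :: int\<bar>" "3 ^ b \<le> 2 * \<bar>3 ^ e - 3 ^ b :: int\<bar>"
      by (smt (verit))+
    note zs = this[THEN z]
    with 3 b insert zs show ?thesis by (simp add: riesz_coeff_insert)
  qed
qed

text \<open>Expansions in powers of three with digits -1, 0, 1 are unique, so this frequency arises
  only from the factors \<open>e\<close> and \<open>e'\<close>, each contributing
  \<open>a / 2\<close>. For \<open>e = b\<close> the recursion leaves the single frequency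
  \<open>s * 3 ^ e'\<close>.\<close>

lemma riesz_coeff_pair:
  assumes "finite E" "e' < e" "s = 1 \<or> s = -1"
  shows "riesz_coeff a E (3 ^ e + s * 3 ^ e') \<phi> = (if e \<in> E \<and> e' \<in> E then a\<^sup>2 / 4 * cos \<phi> else 0)"
  using assms
proof (induction E rule: finite_linorder_max_induct)
  case empty
  have "\<bar>s * 3 ^ e'\<bar> = 3 ^ e'" "(0::int) < 3 ^ e'" using empty by (auto simp: abs_mult)
  then have "(3::int) ^ e + s * 3 ^ e' \<noteq> 0"
    using power3_step[OF \<open>e' < e\<close>] by linarith
  moreover note empty
  ultimately show ?case by (simp add: riesz_coeff_empty)
next
  case (insert b E)
  let ?w = "3 ^ e + s * 3 ^ e'"
  have b: "b \<notin> E" using insert.hyps by auto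
  have pos: "(0::int) < 3 ^ b" "(0::int) < 3 ^ e" "(0::int) < 3 ^ e'" by simp_all
  have z: "riesz_coeff a E w \<phi> = 0" if "3 ^ b \<le> 2 * \<bar>w\<bar>" for w
    using insert.hyps that by (intro riesz_coeff_eq_0[of E b]) auto
  note e = power3_step[OF \<open>e' < e\<close>]
  have t: "\<bar>s * 3 ^ e'\<bar> = 3 ^ e'" using insert.prems by (auto simp: abs_mult)
  consider "e < b" | "e = b" | "b < e" by linarith
  then show ?case
  proof cases
    case 1
    have "3 ^ b \<le> 2 * \<bar>?w + 3 ^ b\<bar>" "3 ^ b \<le> 2 * \<bar>?w - 3 ^ b\<bar>"
      using power3_step[OF 1] pos t e by (smt (verit))+
    note zs = this[THEN z]
    with 1 b insert zs show ?thesis by (simp add: riesz_coeff_insert)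
  next
    case 2
    have "3 ^ b \<le> 2 * \<bar>?w + 3 ^ b\<bar>" "3 ^ b \<le> 2 * \<bar>?w\<bar>"
      using pos t e unfolding 2 by (smt (verit))+
    note zs = this[THEN z]
    have "riesz_coeff a E (s * 3 ^ e') \<phi> = (if e' \<in> E then a / 2 * cos \<phi> else 0)"
      using insert.prems insert.hyps riesz_coeff_uminus[of a E "3 ^ e'" \<phi>]
      by (auto simp: riesz_coeff_single)
    moreover have "?w - 3 ^ b = s * 3 ^ e'" using 2 by simp
    ultimately show ?thesis using 2 b zs insert.prems insert.hyps
      by (auto simp: riesz_coeff_insert power2_eq_square)
  next
    case 3
    \<comment> \<open>Both \<open>e'\<close> and \<open>b\<close> lie below \<open>e\<close>;
      comparing them shows that even \<open>3 ^ e - 3 ^ e' - 3 ^ b\<close> is at least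
      \<open>3 ^ b / 2\<close>.\<close>
    have "3 * (3::int) ^ e' \<le> 3 ^ b \<or> (3::int) ^ e' = 3 ^ b \<or> 3 * (3::int) ^ b \<le> 3 ^ e'"
      using power3_step[of b e'] power3_step[of e' b] by (cases e' b rule: linorder_cases) auto
    then have "3 ^ b \<le> 2 * \<bar>?w + 3 ^ b\<bar>" "3 ^ b \<le> 2 * \<bar>?w - 3 ^ b\<bar>"
      using power3_step[OF 3] pos t e
      by (smt (verit))+
    note zs = this[THEN z]
    moreover have "e \<notin> E" using 3 insert.hyps by auto
    ultimately show ?thesis using 3 b insert zs by (simp add: riesz_coeff_insert)
  qed
qed

text \<open>Product-to-sum leads to the frequencies \<open>3 ^ e + 3 ^ e'\<close> and
  \<open>3 ^ e - 3 ^ e'\<close> with phases added and subtracted, and the two resulting cosines of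
  phases recombine into a product. Thus distinct exponents are uncorrelated under the tilted
  measure.\<close>

lemma integral_riesz_cos_cos:
  assumes "finite E" "e \<noteq> e'"
  shows "integral {0..1} (\<lambda>y. riesz a E y *
      (cos (2 * pi * 3 ^ e * y + \<phi>) * cos (2 * pi * 3 ^ e' * y + \<psi>))) =
    (if e \<in> E then a / 2 * cos \<phi> else 0) * (if e' \<in> E then a / 2 * cos \<psi> else 0)"
  using assms
proof (induction e e' arbitrary: \<phi> \<psi> rule: linorder_wlog)
  case (sym e e')
  from sym(1)[OF sym(2) sym(3)[symmetric], of \<psi> \<phi>] show ?case
    by (simp add: mult.commute mult.left_commute)
next
  case (le e' e)
  let ?u = "\<lambda>y. 2 * pi * 3 ^ e * y + \<psi>" and ?v = "\<lambda>y. 2 * pi * 3 ^ e' * y + \<phi>"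
  have "e' < e" using le by simp
  have "cos (?v y) * cos (?u y) =
      1 / 2 * cos (2 * pi * of_int (3 ^ e + 1 * 3 ^ e') * y + (\<psi> + \<phi>))
      + 1 / 2 * cos (2 * pi * of_int (3 ^ e + (-1) * 3 ^ e') * y + (\<psi> - \<phi>))" for y
  proof -
    have "2 * pi * of_int (3 ^ e + 1 * 3 ^ e') * y + (\<psi> + \<phi>) = ?u y + ?v y"
      "2 * pi * of_int (3 ^ e + (-1) * 3 ^ e') * y + (\<psi> - \<phi>) = ?u y - ?v y"
      by (simp_all add: algebra_simps)
    then show ?thesis
      by (simp only: cos_add[of "?u y" "?v y"] cos_diff[of "?u y" "?v y"])
        (simp add: algebra_simps)
  qed
  then have "integral {0..1} (\<lambda>y. riesz a E y * (cos (?v y) * cos (?u y))) =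
      1 / 2 * riesz_coeff a E (3 ^ e + 1 * 3 ^ e') (\<psi> + \<phi>)
      + 1 / 2 * riesz_coeff a E (3 ^ e + (-1) * 3 ^ e') (\<psi> - \<phi>)"
    unfolding riesz_coeff_def
    by (simp add: distrib_left integral_add integrable_continuous_real continuous_intros
        mult.left_commute[of _ "1 / 2"])
  also have "\<dots> = (if e \<in> E \<and> e' \<in> E then a\<^sup>2 / 4 * (cos \<psi> * cos \<phi>) else 0)"
    unfolding riesz_coeff_pair[OF \<open>finite E\<close> \<open>e' < e\<close> disjI1[OF refl]]
      riesz_coeff_pair[OF \<open>finite E\<close> \<open>e' < e\<close> disjI2[OF refl]]
    by (simp add: cos_add cos_diff field_simps)
  finally show ?case by (auto simp: power2_eq_square)
qed

section \<open>Covariances of cosines under the tilted measure\<close>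

lemma riesz_nonneg: "0 \<le> a \<Longrightarrow> a \<le> 1 \<Longrightarrow> 0 \<le> riesz a E y"
  unfolding riesz_def
proof (intro prod_nonneg)
  fix e assume "0 \<le> a" "a \<le> 1"
  then have "a * (- 1) \<le> a * cos (2 * pi * 3 ^ e * y)" by (intro mult_left_mono) auto
  then show "0 \<le> 1 + a * cos (2 * pi * 3 ^ e * y)" using \<open>a \<le> 1\<close> by linarith
qed

lemma riesz_le_exp:
  assumes "0 \<le> a" "a \<le> 1"
  shows "riesz a E y \<le> exp (a * (\<Sum>e\<in>E. cos (2 * pi * 3 ^ e * y)))"
proof (cases "finite E")
  case True
  have "riesz a E y \<le> (\<Prod>e\<in>E. exp (a * cos (2 * pi * 3 ^ e * y)))"
    unfolding riesz_def
  proof (intro prod_mono conjI)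
    fix e
    have "a * (- 1) \<le> a * cos (2 * pi * 3 ^ e * y)" using assms by (intro mult_left_mono) auto
    then show "0 \<le> 1 + a * cos (2 * pi * 3 ^ e * y)" using \<open>a \<le> 1\<close> by linarith
  qed (rule exp_ge_add_one_self)
  also have "\<dots> = exp (a * (\<Sum>e\<in>E. cos (2 * pi * 3 ^ e * y)))"
    using True by (simp add: exp_sum sum_distrib_left)
  finally show ?thesis .
qed (simp add: riesz_def)

lemma integral_riesz: "finite E \<Longrightarrow> integral {0..1} (riesz a E) = 1"
  using riesz_coeff_0[of E a 0] by (simp add: riesz_coeff_def)

lemma integral_riesz_cos:
  "finite E \<Longrightarrow> integral {0..1} (\<lambda>y. riesz a E y * cos (2 * pi * 3 ^ e * y + \<phi>))
    = (if e \<in> E then a / 2 * cos \<phi> else 0)"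
  using riesz_coeff_single[of E a e \<phi>] by (simp add: riesz_coeff_def)

text \<open>Off the diagonal the mixed moment factorises. For \<open>e = e'\<close> the phases may
  still differ and a crude bound suffices: the mixed moment and minus the product of the means are
  each at most 1.\<close>

lemma riesz_covariance:
  fixes \<phi> \<psi> :: real
  assumes "finite E" "0 \<le> a" "a \<le> 1"
  defines "m \<equiv> \<lambda>e \<phi>. if e \<in> E then a / 2 * cos \<phi> else 0"
  shows "integral {0..1} (\<lambda>y. riesz a E y *
      ((cos (2 * pi * 3 ^ e * y + \<phi>) - m e \<phi>) * (cos (2 * pi * 3 ^ e' * y + \<psi>) - m e' \<psi>)))
    \<le> (if e = e' then 2 else 0)"
proof -
  let ?u = "\<lambda>y. cos (2 * pi * 3 ^ e * y + \<phi>)" and ?v = "\<lambda>y. cos (2 * pi * 3 ^ e' * y + \<psi>)"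
  have "riesz a E y * ((?u y - m e \<phi>) * (?v y - m e' \<psi>)) =
      riesz a E y * (?u y * ?v y) - m e' \<psi> * (riesz a E y * ?u y)
      - m e \<phi> * (riesz a E y * ?v y) + m e \<phi> * m e' \<psi> * riesz a E y" for y
    by (simp add: algebra_simps)
  moreover have "integral {0..1} (\<lambda>y. riesz a E y * cos (2 * pi * 3 ^ e * y + \<phi>)) = m e \<phi>" for e \<phi>
    unfolding m_def by (rule integral_riesz_cos[OF assms(1)])
  ultimately have eq: "integral {0..1} (\<lambda>y. riesz a E y * ((?u y - m e \<phi>) * (?v y - m e' \<psi>))) =
      integral {0..1} (\<lambda>y. riesz a E y * (?u y * ?v y)) - m e' \<psi> * m e \<phi>
      - m e \<phi> * m e' \<psi> + m e \<phi> * m e' \<psi>"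
    using assms(1)
    by (simp add: integral_add integral_diff integrable_continuous_real continuous_intros
        integral_riesz)
  show ?thesis
  proof (cases "e = e'")
    case False
    then show ?thesis using eq integral_riesz_cos_cos[OF assms(1) False, of a \<phi> \<psi>]
      by (simp add: m_def)
  next
    case True
    have "integral {0..1} (\<lambda>y. riesz a E y * (?u y * ?v y)) \<le> integral {0..1} (riesz a E)"
    proof (intro integral_le integrable_continuous_real continuous_intros)
      fix y :: real
      have "?u y * ?v y \<le> \<bar>?u y\<bar> * \<bar>?v y\<bar>" by (simp flip: abs_mult)
      also have "\<dots> \<le> 1 * 1" by (intro mult_mono) auto
      finally show "riesz a E y * (?u y * ?v y) \<le> riesz a E y"
        using riesz_nonneg[OF assms(2,3), of E y] by (simp add: mult_left_le)
    qed
    moreover have "\<bar>m e \<phi>\<bar> \<le> 1" for e \<phi>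
    proof -
      have "\<bar>a / 2 * cos \<phi>\<bar> \<le> 1 * 1"
        unfolding abs_mult using assms by (intro mult_mono) auto
      then show ?thesis by (simp add: m_def)
    qed
    then have "\<bar>m e \<phi>\<bar> * \<bar>m e' \<psi>\<bar> \<le> 1 * 1" by (intro mult_mono) auto
    then have "- (m e \<phi> * m e' \<psi>) \<le> 1" by (simp flip: abs_mult)
    ultimately show ?thesis
      using True eq integral_riesz[OF assms(1), of a] by simp
  qed
qed

text \<open>Expanding the square leaves only pairs with equal exponent. Coincidences of
  \<open>h\<close> matter, as it will be \<open>k + j\<close> on pairs \<open>(k, j)\<close>. For
  \<open>E = {}\<close> this is orthogonality under Lebesgue measure.\<close>

lemma riesz_variance:
  fixes \<phi> :: "'i \<Rightarrow> real" and h :: "'i \<Rightarrow> nat"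
  assumes "finite E" "0 \<le> a" "a \<le> 1" "finite I"
  defines "m \<equiv> \<Sum>p\<in>I. if h p \<in> E then a / 2 * cos (\<phi> p) else 0"
  shows "integral {0..1} (\<lambda>y. riesz a E y * ((\<Sum>p\<in>I. cos (2 * pi * 3 ^ h p * y + \<phi> p)) - m)\<^sup>2)
    \<le> 2 * real (card {(p, q) \<in> I \<times> I. h p = h q})"
proof -
  define X where "X p y = cos (2 * pi * 3 ^ h p * y + \<phi> p)
    - (if h p \<in> E then a / 2 * cos (\<phi> p) else 0)" for p y
  have "(\<Sum>p\<in>I. cos (2 * pi * 3 ^ h p * y + \<phi> p)) - m = (\<Sum>p\<in>I. X p y)" for y
    by (simp add: X_def m_def sum_subtractf)
  then have "((\<Sum>p\<in>I. cos (2 * pi * 3 ^ h p * y + \<phi> p)) - m)\<^sup>2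
      = (\<Sum>p\<in>I. \<Sum>q\<in>I. X p y * X q y)" for y
    by (simp only: power2_eq_square sum_product)
  then have "integral {0..1} (\<lambda>y. riesz a E y * ((\<Sum>p\<in>I. cos (2 * pi * 3 ^ h p * y + \<phi> p)) - m)\<^sup>2)
      = integral {0..1} (\<lambda>y. \<Sum>p\<in>I. \<Sum>q\<in>I. riesz a E y * (X p y * X q y))"
    by (simp add: sum_distrib_left)
  also have "\<dots> = (\<Sum>p\<in>I. \<Sum>q\<in>I. integral {0..1} (\<lambda>y. riesz a E y * (X p y * X q y)))"
    unfolding X_def using assms(4)
    by (subst integral_sum; (intro sum.cong refl integral_sum)?)
      (auto intro!: integrable_continuous_real continuous_intros)
  also have "\<dots> \<le> (\<Sum>p\<in>I. \<Sum>q\<in>I. if h p = h q then 2 else 0)"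
    unfolding X_def using riesz_covariance[OF assms(1-3)] by (intro sum_mono)
  also have "\<dots> = (\<Sum>x\<in>I \<times> I. if h (fst x) = h (snd x) then 2 else 0)"
    by (simp add: sum.cartesian_product case_prod_beta)
  also have "\<dots> = 2 * real (card {(p, q) \<in> I \<times> I. h p = h q})"
  proof -
    have "I \<times> I \<inter> {x. h (fst x) = h (snd x)} = {(p, q) \<in> I \<times> I. h p = h q}" by auto
    then show ?thesis using assms(4) by (simp add: sum.If_cases del: mem_Sigma_iff)
  qed
  finally show ?thesis .
qed

text \<open>
  With \<open>T\<close> the sum of the cosines over \<open>E\<close>, the density \<open>riesz a E\<close> is at most \<open>exp (a T)\<close>; by
  Chebyshev both sums are close to their tilted means on a set of tilted mass at least \<open>1 / 2\<close>,
  where the density can be divided out.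
\<close>

lemma riesz_tail:
  fixes \<phi> :: "'i \<Rightarrow> real" and h :: "'i \<Rightarrow> nat"
  assumes E: "finite E" and a: "0 \<le> a" "a \<le> 1" and I: "finite I"
    and s: "s > 0" "9 * real (card {(p, q) \<in> I \<times> I. h p = h q}) \<le> s\<^sup>2"
    and u: "u > 0" "9 * real (card E) \<le> u\<^sup>2"
  defines "m \<equiv> \<Sum>p\<in>I. if h p \<in> E then a / 2 * cos (\<phi> p) else 0"
  shows "1 / 2 * exp (- a * (a / 2 * card E + u)) \<le>
    measure lborel {y\<in>{0..<1}. m - s \<le> (\<Sum>p\<in>I. cos (2 * pi * 3 ^ h p * y + \<phi> p))}"
proof -
  define S where "S y = (\<Sum>p\<in>I. cos (2 * pi * 3 ^ h p * y + \<phi> p))" for y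
  define T where "T y = (\<Sum>e\<in>E. cos (2 * pi * 3 ^ e * y))" for y
  define m' where "m' = a / 2 * card E"
  define A where "A = {y\<in>{0..1}. m - s \<le> S y}"
  define B where "B = exp (a * (m' + u))"
  have cont: "continuous_on X S" "continuous_on X T" for X
    unfolding S_def T_def by (intro continuous_intros)+
  \<comment> \<open>The factor 9 in the assumptions makes each of the two Chebyshev losses at most
    2/9, so that tilted mass 5/9 remains.\<close>
  have VS: "integral {0..1} (\<lambda>y. riesz a E y * (S y - m)\<^sup>2) \<le> 2 / 9 * s\<^sup>2"
    using riesz_variance[OF E a I, of h \<phi>] s(2) unfolding S_def m_def by linarith
  have "{(p, q) \<in> E \<times> E. p = q} = (\<lambda>e. (e, e)) ` E" by auto
  then have "card {(p, q) \<in> E \<times> E. p = q} = card E" by (simp add: card_image inj_on_def)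
  then have VT: "integral {0..1} (\<lambda>y. riesz a E y * (T y - m')\<^sup>2) \<le> 2 / 9 * u\<^sup>2"
    using riesz_variance[OF E a E, of "\<lambda>e. e" "\<lambda>_. 0"] u(2)
    unfolding T_def m'_def by (simp add: mult.commute)
  define \<alpha> \<beta> where "\<alpha> = 1 / s\<^sup>2" and "\<beta> = 1 / u\<^sup>2"
  \<comment> \<open>Chebyshev as a pointwise inequality: \<open>?F\<close> is the density times one
    minus the two normalised squared deviations. It is nonpositive where \<open>S\<close> is too
    small or \<open>T\<close> too large, and at most the density, hence at most \<open>B\<close>,
    elsewhere.\<close>
  let ?F = "\<lambda>y. riesz a E y - \<alpha> * (riesz a E y * (S y - m)\<^sup>2)
    - \<beta> * (riesz a E y * (T y - m')\<^sup>2)"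
  have pos: "0 \<le> \<alpha>" "0 \<le> \<beta>" by (auto simp: \<alpha>_def \<beta>_def)
  have "compact A"
  proof -
    have "A = {0..1} \<inter> S -` {m - s..}" by (auto simp: A_def)
    moreover have "closed \<dots>"
      by (intro continuous_closed_preimage cont) auto
    moreover have "bounded \<dots>" by (rule bounded_subset[of "{0..1}"]) auto
    ultimately show ?thesis by (simp add: compact_eq_bounded_closed)
  qed
  then have "A \<in> lmeasurable" by (rule lmeasurable_compact)
  then have "(indicat_real A has_integral measure lebesgue A) UNIV"
    by (simp add: lmeasurable_iff_has_integral)
  moreover have "indicat_real A = (\<lambda>y. if y \<in> {0..1} then indicat_real A y else 0)"
    by (auto simp: A_def indicator_def)
  ultimately have "(indicat_real A has_integral measure lebesgue A) {0..1}"
    using has_integral_restrict_UNIV[of "{0..1}" "indicat_real A"] by metis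
  moreover have A_borel: "A \<in> sets borel" using \<open>compact A\<close> by (simp add: borel_compact)
  ultimately have ind: "((\<lambda>y. B * indicat_real A y) has_integral B * measure lborel A) {0..1}"
    by (intro has_integral_mult_right) simp
  have "1 / 2 \<le> 1 - \<alpha> * (2 / 9 * s\<^sup>2) - \<beta> * (2 / 9 * u\<^sup>2)"
    using s u by (simp add: \<alpha>_def \<beta>_def)
  also have "\<dots> \<le> 1 - \<alpha> * integral {0..1} (\<lambda>y. riesz a E y * (S y - m)\<^sup>2)
      - \<beta> * integral {0..1} (\<lambda>y. riesz a E y * (T y - m')\<^sup>2)"
    using VS VT pos by (intro diff_mono mult_left_mono) auto
  also have "\<dots> = integral {0..1} ?F"
    by (simp add: integral_diff integrable_continuous_real continuous_intros cont integral_riesz[OF E])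
  also have "\<dots> \<le> integral {0..1} (\<lambda>y. B * indicator A y)"
  proof (rule integral_le)
    show "?F integrable_on {0..1}"
      by (intro integrable_continuous_real continuous_intros cont)
    show "(\<lambda>y. B * indicat_real A y) integrable_on {0..1}" using ind by blast
    fix y :: real assume y: "y \<in> {0..1}"
    have F: "?F y = riesz a E y * (1 - (S y - m)\<^sup>2 / s\<^sup>2 - (T y - m')\<^sup>2 / u\<^sup>2)"
      by (simp add: \<alpha>_def \<beta>_def algebra_simps)
    have R: "0 \<le> riesz a E y" by (rule riesz_nonneg[OF a])
    have nn: "0 \<le> (S y - m)\<^sup>2 / s\<^sup>2" "0 \<le> (T y - m')\<^sup>2 / u\<^sup>2" by simp_all
    have B: "0 \<le> B" by (simp add: B_def)
    show "?F y \<le> B * indicat_real A y"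
    proof (cases "m - s \<le> S y \<and> T y \<le> m' + u")
      case True
      have "1 - (S y - m)\<^sup>2 / s\<^sup>2 - (T y - m')\<^sup>2 / u\<^sup>2 \<le> 1"
        using nn by linarith
      then have "?F y \<le> riesz a E y * 1"
        unfolding F using R by (intro mult_left_mono)
      also have "\<dots> \<le> exp (a * T y)" using riesz_le_exp[OF a, of E y] by (simp add: T_def)
      also have "\<dots> \<le> B" using True a unfolding B_def by (simp add: mult_left_mono)
      also have "\<dots> = B * indicat_real A y" using True y by (simp add: A_def)
      finally show ?thesis .
    next
      case False
      then have "s \<le> \<bar>S y - m\<bar> \<or> u \<le> \<bar>T y - m'\<bar>" by linarith
      then have "s\<^sup>2 \<le> (S y - m)\<^sup>2 \<or> u\<^sup>2 \<le> (T y - m')\<^sup>2"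
        using s u by (metis abs_le_square_iff abs_of_pos)
      then have "1 \<le> (S y - m)\<^sup>2 / s\<^sup>2 \<or> 1 \<le> (T y - m')\<^sup>2 / u\<^sup>2"
        using s u by simp
      then have "1 - (S y - m)\<^sup>2 / s\<^sup>2 - (T y - m')\<^sup>2 / u\<^sup>2 \<le> 0"
        using nn by linarith
      then have "?F y \<le> 0"
        unfolding F using R by (intro mult_nonneg_nonpos)
      also have "0 \<le> B * indicat_real A y" using B by simp
      finally show ?thesis .
    qed
  qed
  also have "\<dots> = B * measure lborel A"
    using ind by (rule integral_unique)
  finally have "1 / 2 \<le> B * measure lborel A" .
  then have "1 / 2 / B \<le> measure lborel A" by (simp add: B_def field_simps)
  \<comment> \<open>The point 1 is dropped because the cells used later are half-open and thereby
    disjoint.\<close>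
  also have "\<dots> = measure lborel (A - {1})"
    by (rule measure_Diff_null_set[symmetric]) (use A_borel in auto)
  also have "A - {1} = {y\<in>{0..<1}. m - s \<le> S y}" by (auto simp: A_def)
  also have "1 / 2 / B = 1 / 2 * exp (- a * (m' + u))"
    by (simp add: B_def exp_minus inverse_eq_divide)
  finally show ?thesis unfolding S_def m'_def .
qed

section \<open>Lower tail bound for the lacunary sum\<close>

text \<open>The frequencies match the growth of \<open>n\<close>: over all \<open>k\<close> and
  \<open>j\<close> the exponent \<open>k + j\<close> recurs up to \<open>K\<close> times, which
  lifts the variance of the sum from order \<open>N * K\<close> to order
  \<open>N * K\<^sup>2\<close>.\<close>

definition triadic_poly :: "nat \<Rightarrow> real \<Rightarrow> real" where
  "triadic_poly K x = (\<Sum>j<K. cos (2 * pi * 3 ^ j * x))"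

lemma mean_zero_triadic_poly: "mean_zero_trig_poly (triadic_poly K)"
proof -
  define P where "P = (\<lambda>j::nat. 3 ^ j :: nat) ` {..<K}"
  have sub: "P \<subseteq> {1..3 ^ K}" by (auto simp: P_def intro: power_increasing)
  have "triadic_poly K x = (\<Sum>j=1..3 ^ K. (if j \<in> P then 1 else 0) * cos (2 * pi * real j * x)
      + 0 * sin (2 * pi * real j * x))" for x
  proof -
    have "(\<Sum>j=1..3 ^ K. (if j \<in> P then 1 else 0) * cos (2 * pi * real j * x)
        + 0 * sin (2 * pi * real j * x)) = (\<Sum>j\<in>{1..3 ^ K}. if j \<in> P then cos (2 * pi * real j * x) else 0)"
      by (intro sum.cong) auto
    also have "\<dots> = (\<Sum>j\<in>P. cos (2 * pi * real j * x))"
      using sub by (simp add: sum.If_cases Int_absorb1)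
    also have "\<dots> = triadic_poly K x"
      unfolding P_def triadic_poly_def by (subst sum.reindex) (auto simp: inj_on_def)
    finally show ?thesis by simp
  qed
  then show ?thesis
    unfolding mean_zero_trig_poly_def
    by (intro exI[of _ "3 ^ K"] exI[of _ "\<lambda>j. if j \<in> P then 1 else 0"] exI[of _ "\<lambda>_. 0"] allI)
qed

text \<open>This is \<open>riesz_variance\<close> for the empty product. The exact value is
  \<open>sqrt (K / 2)\<close>; the lost constant is absorbed by the choice of
  \<open>K\<close>.\<close>

lemma L2_norm_triadic_poly_le: "L2_norm_unit (triadic_poly K) \<le> sqrt (2 * K)"
proof -
  have cont: "continuous_on {0..1} (\<lambda>x. (triadic_poly K x)\<^sup>2)"
    unfolding triadic_poly_def by (intro continuous_intros)
  have "(LINT x:{0..1}|lborel. (triadic_poly K x)\<^sup>2) = integral {0..1} (\<lambda>x. (triadic_poly K x)\<^sup>2)"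
    using borel_integrable_atLeastAtMost'[OF cont] by (rule set_borel_integral_eq_integral(2))
  also have "\<dots> \<le> 2 * real (card {(p, q) \<in> {..<K} \<times> {..<K}. p = q})"
    using riesz_variance[of "{}" 0 "{..<K}" "\<lambda>j. j" "\<lambda>_. 0"]
    by (simp add: riesz_def triadic_poly_def)
  also have "{(p, q) \<in> {..<K} \<times> {..<K}. p = q} = (\<lambda>j. (j, j)) ` {..<K}" by auto
  also have "card \<dots> = K" by (simp add: card_image inj_on_def)
  finally show ?thesis unfolding L2_norm_unit_def by simp
qed

lemma abs_cos_diff_le: "\<bar>cos x - cos y\<bar> \<le> \<bar>x - y :: real\<bar>"
proof -
  have "\<bar>cos x - cos y\<bar> = 2 * (\<bar>sin ((x + y) / 2)\<bar> * \<bar>sin ((y - x) / 2)\<bar>)"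
    by (simp add: cos_diff_cos abs_mult)
  also have "\<dots> \<le> 2 * (1 * \<bar>(y - x) / 2\<bar>)"
    by (intro mult_left_mono mult_mono abs_sin_x_le_abs_x) auto
  finally show ?thesis by simp
qed

lemma cos_int_shift: "cos (2 * pi * of_int n + z) = cos z"
  by (simp add: cos_add)

text \<open>Given \<open>p\<close>, the second component of \<open>q\<close> determines the
  first.\<close>

lemma card_triadic_collisions:
  "card {(p, q) \<in> ({P<..N} \<times> {..<K}) \<times> ({P<..N} \<times> {..<K}). fst p + snd p = fst q + snd q}
    \<le> N * K * K"
proof -
  let ?I = "{P<..N} \<times> {..<K}"
  let ?A = "{(p, q) \<in> ?I \<times> ?I. fst p + snd p = fst q + snd q}"
  have "card ?A \<le> card (?I \<times> {..<K})"
  proof (rule card_inj_on_le)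
    show "inj_on (\<lambda>(p, q). (p, snd q)) ?A" by (auto simp: inj_on_def)
  qed auto
  also have "\<dots> = (N - P) * K * K" by simp
  also have "\<dots> \<le> N * K * K" by simp
  finally show ?thesis .
qed

lemma measure_affine_image_real:
  fixes A :: "real set" and c t :: real
  assumes "A \<in> sets borel" "c > 0"
  shows "measure lborel ((\<lambda>y. t + c * y) ` A) = c * measure lborel A"
proof -
  have im: "(\<lambda>y. t + c * y) ` A = (\<lambda>x. (x - t) / c) -` A"
    using assms(2) by (auto simp: image_iff field_simps intro!: bexI[where x = "(_ - t) / c"])
  have "(\<lambda>x. (x - t) / c) -` A \<inter> space borel \<in> sets borel"
    using assms by (intro measurable_sets) auto
  then have "(\<lambda>y. t + c * y) ` A \<in> sets borel" by (simp add: im)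
  moreover have "(\<lambda>y. t + c * y) ` A = (\<lambda>y. c *\<^sub>R y + t) ` A" by (simp add: add.commute)
  ultimately show ?thesis
    using assms measure_lebesgue_affine[of c t A] by simp
qed

text \<open>
  A cell \<open>[c / D, (c + 1) / D]\<close> is a full period of every \<open>cos (2 \<pi> D 3\<^sup>k x)\<close>, while the phases caused
  by the shifts \<open>i k\<close> vary so little on it that they can be frozen at its left end point.
\<close>

lemma lac_sum_triadic_cell:
  fixes n i :: "nat \<Rightarrow> nat" and K N P I c :: nat
  assumes "N \<ge> 1" and PN: "P \<le> N"
    and D: "D = 6 * 3 ^ K * (I + 1) * N"
    and n: "\<And>k. k \<in> {P<..N} \<Longrightarrow> n k = D * 3 ^ k + i k"
    and i: "\<And>k. k \<in> {P<..N} \<Longrightarrow> i k \<le> I"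
    and y: "y \<in> {0..<1}"
  defines "\<phi> \<equiv> \<lambda>(k, j). 2 * pi * 3 ^ j * real (i k) * real c / real D"
  shows "(\<Sum>p\<in>{P<..N} \<times> {..<K}. cos (2 * pi * 3 ^ (fst p + snd p) * y + \<phi> p)) - K * P - 2 * K
    \<le> lac_sum (triadic_poly K) n N (c / real D + 1 / real D * y)"
proof -
  let ?x = "c / real D + 1 / real D * y"
  have "0 < 6 * 3 ^ K * (I + 1) * N" using assms(1) by (intro mult_pos_pos) auto
  then have D0: "real D > 0" by (simp only: D of_nat_0_less_iff)
  have summand: "cos (2 * pi * 3 ^ (k + j) * y + \<phi> (k, j)) - 2 / N \<le> cos (2 * pi * 3 ^ j * (real (n k) * ?x))"
    if k: "k \<in> {P<..N}" and j: "j < K" for k j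
  proof -
    define \<delta> where "\<delta> = 2 * pi * 3 ^ j * real (i k) * y / real D"
    have "2 * pi * 3 ^ j * (real (n k) * ?x) =
        2 * pi * of_int (3 ^ (k + j) * int c) + (2 * pi * 3 ^ (k + j) * y + \<phi> (k, j) + \<delta>)"
      using D0 by (simp add: n[OF k] \<delta>_def \<phi>_def field_simps power_add)
    then have eq: "cos (2 * pi * 3 ^ j * (real (n k) * ?x)) =
        cos (2 * pi * 3 ^ (k + j) * y + \<phi> (k, j) + \<delta>)"
      by (simp only: cos_int_shift)
    \<comment> \<open>The factors of \<open>D\<close> keep the drift below \<open>2 / N\<close>, so
      freezing costs at most \<open>2 * K\<close> over all summands.\<close>
    have "3 ^ j * real (i k) * y \<le> 3 ^ K * real (I + 1) * 1"
      using i[OF k] j y by (intro mult_mono power_increasing) auto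
    also have "\<dots> = real D / (6 * N)" using assms(1) by (simp add: D field_simps)
    finally have "2 * pi * (3 ^ j * real (i k) * y) \<le> 2 * 4 * (real D / (6 * N))"
      using y pi_less_4 by (intro mult_mono) auto
    then have "\<delta> \<le> 2 * 4 * (real D / (6 * N)) / real D"
      unfolding \<delta>_def using D0 by (intro divide_right_mono) (auto simp: mult.assoc)
    also have "\<dots> \<le> 2 / N" using D0 assms(1) by (simp add: field_simps)
    finally have "\<delta> \<le> 2 / N" .
    moreover have "\<delta> \<ge> 0" using y by (simp add: \<delta>_def)
    ultimately show ?thesis
      using abs_cos_diff_le[of "2 * pi * 3 ^ (k + j) * y + \<phi> (k, j) + \<delta>" "2 * pi * 3 ^ (k + j) * y + \<phi> (k, j)"]
      unfolding eq by linarith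
  qed
  have "(\<Sum>p\<in>{P<..N} \<times> {..<K}. cos (2 * pi * 3 ^ (fst p + snd p) * y + \<phi> p) - 2 / N)
      \<le> (\<Sum>p\<in>{P<..N} \<times> {..<K}. cos (2 * pi * 3 ^ snd p * (real (n (fst p)) * ?x)))"
    using summand by (intro sum_mono) auto
  also have "\<dots> = (\<Sum>k\<in>{P<..N}. triadic_poly K (real (n k) * ?x))"
    by (simp add: triadic_poly_def sum.cartesian_product case_prod_beta)
  finally have 1: "(\<Sum>p\<in>{P<..N} \<times> {..<K}. cos (2 * pi * 3 ^ (fst p + snd p) * y + \<phi> p))
      - (N - P) * K * (2 / N) \<le> (\<Sum>k\<in>{P<..N}. triadic_poly K (real (n k) * ?x))"
    by (simp add: sum_subtractf)
  have "real ((N - P) * K) * (2 / N) \<le> real (N * K) * (2 / N)"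
    by (intro mult_right_mono) (auto simp: mult_right_mono)
  also have "\<dots> = 2 * K" using assms(1) by simp
  finally have 2: "real ((N - P) * K) * (2 / N) \<le> 2 * K" .
  \<comment> \<open>The first \<open>P\<close> terms belong to earlier stages and get the trivial
    bound.\<close>
  have "(\<Sum>k\<in>{1..P}. - real K) \<le> (\<Sum>k\<in>{1..P}. triadic_poly K (real (n k) * ?x))"
  proof (rule sum_mono)
    fix k
    have "(\<Sum>j<K. - 1) \<le> triadic_poly K (real (n k) * ?x)"
      unfolding triadic_poly_def by (intro sum_mono) simp
    then show "- real K \<le> triadic_poly K (real (n k) * ?x)" by simp
  qed
  then have 3: "- real (K * P) \<le> (\<Sum>k\<in>{1..P}. triadic_poly K (real (n k) * ?x))"
    by (simp add: mult.commute)
  have "{1..N} = {1..P} \<union> {P<..N}" using PN by auto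
  then have "lac_sum (triadic_poly K) n N ?x = (\<Sum>k\<in>{1..P}. triadic_poly K (real (n k) * ?x))
      + (\<Sum>k\<in>{P<..N}. triadic_poly K (real (n k) * ?x))"
    unfolding lac_sum_def by (simp only:) (rule sum.union_disjoint; auto)
  then show ?thesis using 1 2 3 by linarith
qed

text \<open>The \<open>N\<close> cells of length \<open>1 / D\<close> fill the interval from 0 to
  \<open>1 / G\<close>. By \<open>riesz_tail\<close> each holds at least a fixed proportion of the
  event, and these contributions add up because the cells are disjoint.\<close>

lemma lac_sum_triadic_tail:
  fixes n i :: "nat \<Rightarrow> nat" and K N P I :: nat
  assumes "N \<ge> 1" "K \<ge> 1" and PN: "P + K \<le> N"
    and G: "G = 6 * 3 ^ K * (I + 1)" and D: "D = G * N"
    and n: "\<And>k. k \<in> {P<..N} \<Longrightarrow> n k = D * 3 ^ k + i k"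
    and i: "\<And>k. k \<in> {P<..N} \<Longrightarrow> i k \<le> I"
    and a: "0 \<le> a" "a \<le> 1"
    and t: "t \<le> a / 4 * (K * (real N - P - K)) - 3 * K * sqrt N - K * P - 2 * K"
  shows "1 / 2 * exp (- a * (a / 2 * N + 3 * sqrt N)) / G
    \<le> measure lborel {x \<in> {0..1}. t \<le> lac_sum (triadic_poly K) n N x}"
proof -
  define S where "S = lac_sum (triadic_poly K) n N"
  define \<phi> where "\<phi> c = (\<lambda>(k, j). 2 * pi * 3 ^ j * real (i k) * real c / real D)" for c :: nat
  define Z where "Z c y = (\<Sum>p\<in>{P<..N} \<times> {..<K}. cos (2 * pi * 3 ^ (fst p + snd p) * y + \<phi> c p))" for c y
  define m where "m c = (\<Sum>p\<in>{P<..N} \<times> {..<K}. if fst p + snd p \<in> {P<..N} then a / 2 * cos (\<phi> c p) else 0)" for c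
  define X where "X c = {x \<in> {real c / D..<real (Suc c) / D}. t \<le> S x}" for c
  define L where "L = 1 / 2 * exp (- a * (a / 2 * N + 3 * sqrt N))"
  have "0 < 6 * 3 ^ K * (I + 1)" by (intro mult_pos_pos) auto
  then have G0: "real G > 0" by (simp only: G of_nat_0_less_iff)
  then have D0: "real D > 0" using assms(1) by (simp add: D)
  have Smeas: "S \<in> borel_measurable borel"
    unfolding S_def lac_sum_def triadic_poly_def by measurable
  have Zmeas: "Z c \<in> borel_measurable borel" for c
    unfolding Z_def by measurable
  have Xmeas: "X c \<in> sets borel" for c
    using Smeas unfolding X_def by measurable
  have Xfin: "emeasure lborel (X c) \<noteq> \<infinity>" for c
  proof -
    have "emeasure lborel (X c) \<le> emeasure lborel {real c / D..real (Suc c) / D}"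
      by (intro emeasure_mono) (auto simp: X_def)
    then show ?thesis using D0 by (auto simp: divide_right_mono top_unique)
  qed
  \<comment> \<open>The factor 6 in \<open>G\<close> keeps all frozen phases below
    \<open>pi / 3\<close>, so every summand of the tilted mean is bounded below.\<close>
  have cosphi: "1 / 2 \<le> cos (\<phi> c p)" if c: "c < N" and p: "p \<in> {P<..N} \<times> {..<K}" for c p
  proof -
    obtain k j where kj: "p = (k, j)" "k \<in> {P<..N}" "j < K" using p by auto
    have "3 ^ j * real (i k) * real c \<le> 3 ^ K * real (I + 1) * real N"
      using i[OF kj(2)] kj c by (intro mult_mono power_increasing) auto
    also have "\<dots> = real D / 6" by (simp add: D G algebra_simps)
    finally have "2 * pi * (3 ^ j * real (i k) * real c) \<le> 2 * pi * (real D / 6)"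
      by (intro mult_left_mono) auto
    then have "\<phi> c p \<le> 2 * pi * (real D / 6) / real D"
      unfolding \<phi>_def kj prod.case using D0 by (intro divide_right_mono) (auto simp: mult.assoc)
    also have "\<dots> = pi / 3" using D0 by simp
    finally have "\<phi> c p \<le> pi / 3" .
    moreover have "\<phi> c p \<ge> 0" by (simp add: \<phi>_def kj)
    ultimately have "cos (pi / 3) \<le> cos (\<phi> c p)" by (intro cos_monotone_0_pi_le) auto
    then show ?thesis by (simp add: cos_60)
  qed
  \<comment> \<open>Only for \<open>k \<le> N - K\<close> is \<open>k + j\<close> sure to stay among
    the exponents of the Riesz product; the other terms are nonnegative.\<close>
  have m_ge: "a / 4 * (K * (real N - P - K)) \<le> m c" if c: "c < N" for c
  proof -
    have "a / 4 * (K * (real N - P - K)) = (\<Sum>p\<in>{P<..N - K} \<times> {..<K}. a / 4)"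
      using PN by (simp add: of_nat_diff)
    also have "\<dots> \<le> (\<Sum>p\<in>{P<..N - K} \<times> {..<K}. if fst p + snd p \<in> {P<..N} then a / 2 * cos (\<phi> c p) else 0)"
    proof (rule sum_mono)
      fix p assume p: "p \<in> {P<..N - K} \<times> {..<K}"
      have "a / 2 * (1 / 2) \<le> a / 2 * cos (\<phi> c p)"
        using a p by (intro mult_left_mono cosphi[OF c]) auto
      then show "a / 4 \<le> (if fst p + snd p \<in> {P<..N} then a / 2 * cos (\<phi> c p) else 0)"
        using p by auto
    qed
    also have "\<dots> \<le> m c"
      unfolding m_def
    proof (rule sum_mono2)
      fix p assume "p \<in> {P<..N} \<times> {..<K} - {P<..N - K} \<times> {..<K}"
      then have "0 \<le> cos (\<phi> c p)" using cosphi[OF c, of p] by auto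
      then show "0 \<le> (if fst p + snd p \<in> {P<..N} then a / 2 * cos (\<phi> c p) else 0)" using a by simp
    qed auto
    finally show ?thesis .
  qed
  have cell: "L / D \<le> measure lborel (X c)" if c: "c < N" for c
  proof -
    define A where "A = {y \<in> {0..<1}. m c - 3 * K * sqrt N \<le> Z c y}"
    have Ameas: "A \<in> sets borel" using Zmeas[of c] unfolding A_def by measurable
    have "L \<le> 1 / 2 * exp (- a * (a / 2 * card {P<..N} + 3 * sqrt N))"
      unfolding L_def using a by (auto intro!: mult_left_mono)
    also have "\<dots> \<le> measure lborel A"
      unfolding A_def Z_def m_def
    \<comment> \<open>The deviation \<open>3 * K * sqrt N\<close> is dictated by the at most
      \<open>N * K * K\<close> collisions, and \<open>3 * sqrt N\<close> by the at most
      \<open>N\<close> exponents.\<close>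
    proof (rule riesz_tail)
      show "9 * real (card {(p, q). (p, q) \<in> ({P<..N} \<times> {..<K}) \<times> {P<..N} \<times> {..<K}
          \<and> fst p + snd p = fst q + snd q}) \<le> (3 * K * sqrt N)\<^sup>2"
      proof -
        have "9 * real (card {(p, q). (p, q) \<in> ({P<..N} \<times> {..<K}) \<times> {P<..N} \<times> {..<K}
          \<and> fst p + snd p = fst q + snd q}) \<le> 9 * real (N * K * K)"
          using card_triadic_collisions[of P N K] by (intro mult_left_mono) (auto simp del: of_nat_mult)
        then show ?thesis by (simp add: power_mult_distrib power2_eq_square algebra_simps)
      qed
    qed (use a assms in \<open>auto simp: power_mult_distrib\<close>)
    finally have "L \<le> measure lborel A" .
    then have "L / D \<le> 1 / D * measure lborel A" using D0 by (simp add: divide_right_mono)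
    also have "\<dots> = measure lborel ((\<lambda>y. c / real D + 1 / real D * y) ` A)"
      using Ameas D0 by (intro measure_affine_image_real[symmetric]) auto
    also have "\<dots> \<le> measure lborel (X c)"
    proof (rule measure_mono_fmeasurable)
      show "(\<lambda>y. c / real D + 1 / real D * y) ` A \<subseteq> X c"
      proof clarify
        fix y assume y: "y \<in> A"
        then have "y \<in> {0..<1}" "m c - 3 * K * sqrt N \<le> Z c y" by (auto simp: A_def)
        moreover have "Z c y - K * P - 2 * K \<le> S (c / real D + 1 / real D * y)"
          unfolding Z_def \<phi>_def S_def
          by (rule lac_sum_triadic_cell) (use assms y in \<open>auto simp: A_def\<close>)
        ultimately show "c / real D + 1 / real D * y \<in> X c"
          using t m_ge[OF c] D0 unfolding X_def by (auto simp: field_simps)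
      qed
      have "(\<lambda>y. c / real D + 1 / real D * y) ` A = (\<lambda>x. x * D - c) -` A \<inter> space borel"
        using D0 by (auto simp: image_iff field_simps intro!: bexI[where x = "_ * real D - real c"])
      also have "\<dots> \<in> sets borel" using Ameas by (intro measurable_sets) auto
      finally show "(\<lambda>y. c / real D + 1 / real D * y) ` A \<in> sets lborel" by simp
      show "X c \<in> fmeasurable lborel"
        using Xmeas Xfin by (intro fmeasurableI) (auto simp: less_top)
    qed
    finally show ?thesis .
  qed
  have "L / G = (\<Sum>c<N. L / D)" using assms(1) by (simp add: D)
  also have "\<dots> \<le> (\<Sum>c<N. measure lborel (X c))" using cell by (intro sum_mono) auto
  also have "\<dots> = measure lborel (\<Union>c\<in>{..<N}. X c)"
  proof (rule measure_finite_Union[symmetric])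
    show "disjoint_family_on X {..<N}"
      unfolding disjoint_family_on_def
    proof (intro ballI impI)
      fix c d :: nat assume "c \<noteq> d"
      show "X c \<inter> X d = {}"
      proof (rule ccontr)
        assume "X c \<inter> X d \<noteq> {}"
        then obtain x where "real c / D \<le> x" "x < real (Suc c) / D" "real d / D \<le> x" "x < real (Suc d) / D"
          unfolding X_def by auto
        then have "real c < real (Suc d)" "real d < real (Suc c)"
          using D0 by (smt (verit) divide_right_mono divide_less_cancel)+
        with \<open>c \<noteq> d\<close> show False by simp
      qed
    qed
  qed (use Xmeas Xfin in auto)
  also have "\<dots> \<le> measure lborel {x \<in> {0..1}. t \<le> S x}"
  proof (rule measure_mono_fmeasurable)
    show "(\<Union>c\<in>{..<N}. X c) \<subseteq> {x \<in> {0..1}. t \<le> S x}"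
    proof
      fix x assume "x \<in> (\<Union>c\<in>{..<N}. X c)"
      then obtain c where c: "c < N" "real c / D \<le> x" "x < real (Suc c) / D" "t \<le> S x"
        by (auto simp: X_def)
      have "real (Suc c) \<le> real N" using c by simp
      also have "\<dots> \<le> real D" using assms(1) G0 by (simp add: D)
      finally have "real (Suc c) / D \<le> 1" using D0 by simp
      moreover have "0 \<le> x" using c(2) by (rule order_trans[rotated]) simp
      ultimately show "x \<in> {x \<in> {0..1}. t \<le> S x}" using c by simp
    qed
    show "{x \<in> {0..1}. t \<le> S x} \<in> fmeasurable lborel"
    proof (rule fmeasurableI2)
      show "{0..1::real} \<in> fmeasurable lborel" by (intro fmeasurableI) auto
      show "{x \<in> {0..1}. t \<le> S x} \<in> sets lborel" using Smeas by measurable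
    qed auto
  qed (use Xmeas in auto)
  finally show ?thesis unfolding L_def S_def .
qed

section \<open>The Gaussian tail\<close>

text \<open>As \<open>(u + x)\<^sup>2 \<ge> u\<^sup>2 + x\<^sup>2\<close> for \<open>x > 0\<close>,
  translating the integral by \<open>u\<close> pulls out the exponential. Positivity is wanted
  because the tail is a denominator later.\<close>

lemma std_normal_upper_tail:
  assumes "u \<ge> 0"
  shows "0 < 1 - std_normal_cdf u" "1 - std_normal_cdf u \<le> exp (- u\<^sup>2 / 2)"
proof -
  interpret prob_space std_normal_distribution by (rule prob_space_normal_density) simp
  have "1 - std_normal_cdf u = prob {u<..}"
  proof -
    have "prob (space std_normal_distribution - {..u}) = 1 - prob {..u}" by (intro prob_compl) simp
    moreover have "space std_normal_distribution - {..u} = {u<..}" by auto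
    ultimately show ?thesis by (simp add: std_normal_cdf_def cdf_def)
  qed
  moreover have "prob {u<..} \<noteq> 0"
  proof
    assume "prob {u<..} = 0"
    then have "{u<..} \<in> null_sets std_normal_distribution"
      by (simp add: null_sets_def emeasure_eq_measure)
    then have "AE x in lborel. x \<notin> {u<..}"
      using normal_density_pos[of 1 0]
      by (subst (asm) null_sets_density_iff) (auto elim!: eventually_mono simp: less_le)
    then have "{u<..} \<in> null_sets lborel" by (simp add: AE_iff_null greaterThan_def)
    then have "{u<..<u + 1} \<in> null_sets lborel" by (rule null_sets_subset) auto
    then show False by (simp add: null_sets_def)
  qed
  moreover have "prob {u<..} \<le> exp (- u\<^sup>2 / 2)"
  proof -
    have "emeasure std_normal_distribution {u<..} =
        (\<integral>\<^sup>+x. ennreal (std_normal_density x) * indicator {u<..} x \<partial>lborel)"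
      by (simp add: emeasure_density)
    also have "\<dots> = (\<integral>\<^sup>+x. ennreal (std_normal_density (u + 1 * x)) * indicator {u<..} (u + 1 * x) \<partial>lborel)"
      by (subst nn_integral_real_affine[of _ 1 u]) simp_all
    also have "\<dots> \<le> (\<integral>\<^sup>+x. ennreal (exp (- u\<^sup>2 / 2)) * ennreal (std_normal_density x) \<partial>lborel)"
    proof (rule nn_integral_mono)
      fix x :: real
      have "std_normal_density (u + x) \<le> exp (- u\<^sup>2 / 2) * std_normal_density x" if "x > 0"
      proof -
        have "exp (- (u + x)\<^sup>2 / 2) \<le> exp (- u\<^sup>2 / 2 + - x\<^sup>2 / 2)"
          using assms that by (simp add: power2_sum)
        also have "\<dots> = exp (- u\<^sup>2 / 2) * exp (- x\<^sup>2 / 2)" by (rule exp_add)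
        finally have "exp (- (u + x)\<^sup>2 / 2) / sqrt (2 * pi) \<le> exp (- u\<^sup>2 / 2) * exp (- x\<^sup>2 / 2) / sqrt (2 * pi)"
          by (intro divide_right_mono) auto
        then show ?thesis by (simp add: std_normal_density_def)
      qed
      then show "ennreal (std_normal_density (u + 1 * x)) * indicator {u<..} (u + 1 * x)
          \<le> ennreal (exp (- u\<^sup>2 / 2)) * ennreal (std_normal_density x)"
        by (auto simp: indicator_def ennreal_mult[symmetric] intro!: ennreal_leI)
    qed
    also have "\<dots> = ennreal (exp (- u\<^sup>2 / 2)) * emeasure std_normal_distribution (space std_normal_distribution)"
      by (simp add: nn_integral_cmult emeasure_density)
    also have "\<dots> = ennreal (exp (- u\<^sup>2 / 2))" by (simp only: emeasure_space_1) simp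
    finally show ?thesis by (simp add: emeasure_eq_measure)
  qed
  ultimately show "0 < 1 - std_normal_cdf u" "1 - std_normal_cdf u \<le> exp (- u\<^sup>2 / 2)"
    by (simp_all add: zero_less_measure_iff)
qed

section \<open>Counting solutions of the Diophantine equation\<close>

text \<open>On the diagonal \<open>k = l + d\<close> the equation is
  \<open>D * 3 ^ l * \<alpha> + r l = c\<close>, where values of \<open>r\<close> differ by less
  than \<open>D\<close>. If \<open>\<alpha> \<noteq> 0\<close>, this fixes \<open>l\<close>; if
  \<open>\<alpha> = 0\<close>, the leading terms cancel and the shifts confine \<open>l\<close> to
  one block of length \<open>M\<close>.\<close>

lemma card_dioph_diagonal:
  fixes n :: "nat \<Rightarrow> nat" and a b d P N M D :: nat and c :: int
  assumes n: "\<And>k. k \<in> {P<..N} \<Longrightarrow> n k = D * 3 ^ k + k div M"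
    and M: "M \<ge> 1" "d \<le> M" and D: "(a + b) * (N div M) < D" and ab: "a \<ge> 1" "b \<ge> 1"
    and c: "a = b \<Longrightarrow> c \<noteq> 0"
  shows "card {l. l \<in> {P<..N} \<and> l + d \<in> {P<..N} \<and> int a * int (n (l + d)) - int b * int (n l) = c} \<le> M"
proof -
  define W where "W = {l. l \<in> {P<..N} \<and> l + d \<in> {P<..N} \<and> int a * int (n (l + d)) - int b * int (n l) = c}"
  define \<alpha> :: int where "\<alpha> = int a * 3 ^ d - int b"
  define r where "r l = int a * int ((l + d) div M) - int b * int (l div M)" for l
  have fin: "finite W" by (rule finite_subset[of _ "{..N}"]) (auto simp: W_def)
  have eq: "int D * 3 ^ l * \<alpha> + r l = c" if "l \<in> W" for l
    using that n[of l] n[of "l + d"] by (simp add: W_def \<alpha>_def r_def power_add algebra_simps)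
  have r_diff: "\<bar>r l - r l'\<bar> < int D" if "l \<in> W" "l' \<in> W" for l l'
  proof -
    have le: "int ((l + d) div M) \<le> int (N div M)" "int (l div M) \<le> int (N div M)" if "l \<in> W" for l
      using that div_le_mono[of "l + d" N M] div_le_mono[of l N M] by (auto simp: W_def)
    have *: "r l \<le> int a * int (N div M)" "- (int b * int (N div M)) \<le> r l" if "l \<in> W" for l
    proof -
      have "int a * int ((l + d) div M) \<le> int a * int (N div M)"
        "int b * int (l div M) \<le> int b * int (N div M)"
        using le[OF that] by (intro mult_left_mono; simp)+
      moreover have "0 \<le> int a * int ((l + d) div M)" "0 \<le> int b * int (l div M)" by simp_all
      ultimately show "r l \<le> int a * int (N div M)" "- (int b * int (N div M)) \<le> r l"
        unfolding r_def by linarith+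
    qed
    have "int ((a + b) * (N div M)) < int D" using D by (simp only: of_nat_less_iff)
    then have "int a * int (N div M) + int b * int (N div M) < int D"
      by (simp add: distrib_right)
    then show ?thesis using *[OF that(1)] *[OF that(2)] by linarith
  qed
  show ?thesis
  proof (cases "\<alpha> = 0")
    case False
    have "l = l'" if "l \<in> W" "l' \<in> W" for l l'
    proof (rule ccontr)
      assume "l \<noteq> l'"
      have "int D * ((3 ^ l - 3 ^ l') * \<alpha>) = r l' - r l"
        using eq[OF that(1)] eq[OF that(2)] by (simp add: algebra_simps)
      then have "int D * \<bar>(3 ^ l - 3 ^ l') * \<alpha>\<bar> < int D * 1"
        using r_diff[OF that(2,1)] by (metis abs_mult abs_of_nat mult.right_neutral)
      then have "\<bar>(3 ^ l - 3 ^ l') * \<alpha>\<bar> < 1"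
        using D by (subst (asm) mult_less_cancel_left_pos) auto
      then have "(3::int) ^ l = 3 ^ l'" using False by auto
      with \<open>l \<noteq> l'\<close> show False by simp
    qed
    then have "card W \<le> Suc 0" using fin by (subst card_le_Suc0_iff_eq) auto
    then show ?thesis using M unfolding W_def by simp
  next
    case True
    then have b: "int b = int a * 3 ^ d" by (simp add: \<alpha>_def)
    \<comment> \<open>Here \<open>a = b\<close>, so the left side of the equation is 0 while
      \<open>c\<close> is not.\<close>
    have "W = {}" if "d = 0"
      using that b c by (auto simp: W_def)
    moreover have "card W \<le> M" if d: "d \<ge> 1"
    proof -
      have same: "l div M = l' div M" if "l \<in> W" "l' \<in> W" for l l'
      proof -
        \<comment> \<open>The number of block boundaries between \<open>l\<close> and
          \<open>l + d\<close>; it is 0 or 1 because \<open>d \<le> M\<close>.\<close>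
        define s where "s l = int ((l + d) div M) - int (l div M)" for l
        have s: "0 \<le> s l" "s l \<le> 1" for l
        proof -
          have "l div M \<le> (l + d) div M" by (intro div_le_mono) simp
          moreover have "(l + d) div M \<le> (l + M) div M" using M by (intro div_le_mono) simp
          moreover have "(l + M) div M = l div M + 1" using M by simp
          ultimately show "0 \<le> s l" "s l \<le> 1" by (auto simp: s_def)
        qed
        have "int a * (s l - (3 ^ d - 1) * int (l div M)) = c" if "l \<in> W" for l
          using eq[OF that] True b by (simp add: r_def s_def algebra_simps)
        from this[OF that(1)] this[OF that(2)] ab
        have "s l - (3 ^ d - 1) * int (l div M) = s l' - (3 ^ d - 1) * int (l' div M)"
          by (metis mult_cancel_left of_nat_0_eq_iff not_one_le_zero)
        then have e: "(3 ^ d - 1) * (int (l div M) - int (l' div M)) = s l - s l'"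
          by (simp add: algebra_simps)
        show ?thesis
        proof (rule ccontr)
          \<comment> \<open>As \<open>3 ^ d - 1 \<ge> 2\<close>, a change of block moves one side of
            \<open>e\<close> by at least 2, the other by at most 1.\<close>
          assume "l div M \<noteq> l' div M"
          then have "1 \<le> \<bar>int (l div M) - int (l' div M)\<bar>" by linarith
          moreover have "(3::int) ^ 1 \<le> 3 ^ d" using d by (intro power_increasing) auto
          ultimately have "2 * 1 \<le> \<bar>(3::int) ^ d - 1\<bar> * \<bar>int (l div M) - int (l' div M)\<bar>"
            by (intro mult_mono) auto
          also have "\<dots> = \<bar>s l - s l'\<bar>" by (simp only: e flip: abs_mult)
          finally show False using s[of l] s[of l'] by linarith
        qed
      qed
      show ?thesis
      proof (cases "W = {}")
        case False
        then obtain l0 where l0: "l0 \<in> W" by auto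
        have "W \<subseteq> {M * (l0 div M)..<M * (l0 div M) + M}"
        proof
          fix l assume "l \<in> W"
          then have "l div M = l0 div M" using same l0 by blast
          then have "l = M * (l0 div M) + l mod M" by (metis mult_div_mod_eq)
          moreover have "l mod M < M" using M by simp
          ultimately show "l \<in> {M * (l0 div M)..<M * (l0 div M) + M}" by simp
        qed
        then have "card W \<le> card {M * (l0 div M)..<M * (l0 div M) + M}"
          by (intro card_mono) auto
        then show ?thesis by simp
      qed simp
    qed
    ultimately have "card W \<le> M" by (cases "d = 0") auto
    then show ?thesis unfolding W_def .
  qed
qed

text \<open>
  Pairs with \<open>l + d \<le> k\<close> satisfy \<open>a n\<^sub>k / 2 \<le> c \<le> a n\<^sub>k\<close>, so there is at most one of them; the others
  have \<open>l \<le> P\<close> or lie on one of \<open>d\<close> diagonals.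
\<close>

lemma card_dioph_half:
  fixes n :: "nat \<Rightarrow> nat" and a b d P N M D :: nat and c :: int
  assumes gap: "\<And>k. k \<ge> 1 \<Longrightarrow> 2 * n k < n (Suc k)"
    and n: "\<And>k. k \<in> {P<..N} \<Longrightarrow> n k = D * 3 ^ k + k div M"
    and M: "M \<ge> 1" "d \<le> M" and D: "(a + b) * (N div M) < D" and ab: "a \<ge> 1" "b \<ge> 1"
    and d: "2 * b \<le> 2 ^ d" and c: "a = b \<Longrightarrow> c \<noteq> 0"
  shows "card {(k, l). k \<in> {1..N} \<and> l \<in> {1..N} \<and> l \<le> k \<and> int a * int (n k) - int b * int (n l) = c}
    \<le> 1 + P + d * M"
proof -
  define A where "A = {(k, l). k \<in> {1..N} \<and> l \<in> {1..N} \<and> l \<le> k \<and> int a * int (n k) - int b * int (n l) = c}"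
  define F where "F = {(k, l). (k, l) \<in> A \<and> l + d \<le> k}"
  define Q where "Q = {(k, l). (k, l) \<in> A \<and> l \<le> P}"
  define V where "V e = {l. l \<in> {P<..N} \<and> l + e \<in> {P<..N} \<and> int a * int (n (l + e)) - int b * int (n l) = c}" for e
  have grow: "2 ^ e * n l \<le> n (l + e)" if "l \<ge> 1" for l e
  proof (induction e)
    case (Suc e)
    have "2 * n (l + e) < n (Suc (l + e))" using that by (intro gap) simp
    with Suc show ?case by simp
  qed simp
  have less: "2 * n l < n k" if "1 \<le> l" "l < k" for l k
  proof -
    have "2 ^ 1 * n l \<le> 2 ^ (k - 1 - l) * (2 * n l)" by simp
    also have "\<dots> \<le> 2 * n (k - 1)"
      using grow[OF that(1), of "k - 1 - l"] that by simp
    also have "\<dots> < n k" using gap[of "k - 1"] that by simp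
    finally show ?thesis by simp
  qed
  have inj: "l = k" if "1 \<le> l" "1 \<le> k" "n l = n k" for l k
    using less[of l k] less[of k l] that by (cases l k rule: linorder_cases) auto
  have fin: "finite A" by (rule finite_subset[of _ "{1..N} \<times> {1..N}"]) (auto simp: A_def)
  then have finFQ: "finite F" "finite Q" by (auto intro: finite_subset[of _ A] simp: F_def Q_def)
  have cF: "card F \<le> 1"
  proof -
    have half: "c \<le> int (a * n k)" "int (a * n k) \<le> 2 * c" if "(k, l) \<in> F" for k l
    proof -
      have kl: "1 \<le> l" "l + d \<le> k" "int a * int (n k) - int b * int (n l) = c"
        using that by (auto simp: F_def A_def)
      have "2 * (b * n l) \<le> 2 ^ d * n l" using mult_right_mono[OF d, of "n l"] by simp
      also have "\<dots> \<le> n (l + d)" by (rule grow[OF kl(1)])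
      also have "\<dots> \<le> n k"
        using less[of "l + d" k] kl by (cases "l + d = k") auto
      also have "\<dots> \<le> a * n k" using ab by simp
      finally have "2 * int (b * n l) \<le> int (a * n k)" by linarith
      then show "c \<le> int (a * n k)" "int (a * n k) \<le> 2 * c" using kl(3) by auto
    qed
    \<comment> \<open>For \<open>k < k'\<close> one would get
      \<open>2 * (a * n k) < a * n k' \<le> 2 * c \<le> 2 * (a * n k)\<close>.\<close>
    have noless: "\<not> k < k'" if "(k, l) \<in> F" "(k', l') \<in> F" for k l k' l'
    proof
      assume "k < k'"
      then have "2 * n k < n k'" using that by (intro less) (auto simp: F_def A_def)
      then have "a * (2 * n k) < a * n k'" using ab by simp
      then have "2 * int (a * n k) < int (a * n k')" by linarith
      with half[OF that(1)] half[OF that(2)] show False by linarith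
    qed
    have "p = q" if "p \<in> F" "q \<in> F" for p q
    proof -
      obtain k l k' l' where pq: "p = (k, l)" "q = (k', l')" by (cases p, cases q)
      then have "k = k'" using noless[of k l k' l'] noless[of k' l' k l] that by auto
      moreover have "int b * int (n l) = int b * int (n l')"
        using that pq \<open>k = k'\<close> by (auto simp: F_def A_def)
      then have "n l = n l'" using ab by simp
      then have "l = l'" using that pq inj[of l l'] by (auto simp: F_def A_def)
      ultimately show ?thesis using pq by simp
    qed
    then show ?thesis using finFQ by (simp add: card_le_Suc0_iff_eq)
  qed
  \<comment> \<open>For fixed \<open>c\<close>, \<open>l\<close> determines \<open>n k\<close> and
    hence \<open>k\<close>.\<close>
  have cQ: "card Q \<le> card {1..P}"
  proof (rule card_inj_on_le)
    show "inj_on snd Q"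
    proof (rule inj_onI)
      fix p q assume pq: "p \<in> Q" "q \<in> Q" "snd p = snd q"
      then have "int a * int (n (fst p)) = int a * int (n (fst q))"
        by (auto simp: Q_def A_def)
      then have "n (fst p) = n (fst q)" using ab by simp
      moreover have "1 \<le> fst p" "1 \<le> fst q" using pq by (auto simp: Q_def A_def)
      ultimately have "fst p = fst q" using inj by blast
      with pq(3) show "p = q" by (simp add: prod_eq_iff)
    qed
  qed (auto simp: Q_def A_def)
  have finV: "finite (V e)" for e by (rule finite_subset[of _ "{..N}"]) (auto simp: V_def)
  have cV: "card (V e) \<le> M" if "e < d" for e
    unfolding V_def using that M by (intro card_dioph_diagonal[OF n _ _ D ab c]) auto
  have "A \<subseteq> F \<union> Q \<union> (\<Union>e\<in>{..<d}. (\<lambda>l. (l + e, l)) ` V e)"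
  proof
    fix p assume p: "p \<in> A"
    obtain k l where kl: "p = (k, l)" by (cases p)
    show "p \<in> F \<union> Q \<union> (\<Union>e\<in>{..<d}. (\<lambda>l. (l + e, l)) ` V e)"
    proof (cases "l + d \<le> k \<or> l \<le> P")
      case True
      then show ?thesis using p kl by (auto simp: F_def Q_def)
    next
      case False
      then have "l \<in> V (k - l)" "k - l < d" "(k, l) = (l + (k - l), l)"
        using p kl by (auto simp: V_def A_def)
      then show ?thesis unfolding kl by blast
    qed
  qed
  then have "card A \<le> card (F \<union> Q \<union> (\<Union>e\<in>{..<d}. (\<lambda>l. (l + e, l)) ` V e))"
    using finFQ finV by (intro card_mono) auto
  also have "\<dots> \<le> card F + card Q + card (\<Union>e\<in>{..<d}. (\<lambda>l. (l + e, l)) ` V e)"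
    by (meson add_mono card_Un_le le_refl order_trans)
  also have "card (\<Union>e\<in>{..<d}. (\<lambda>l. (l + e, l)) ` V e) \<le> (\<Sum>e<d. card ((\<lambda>l. (l + e, l)) ` V e))"
    by (intro card_UN_le) simp
  also have "\<dots> \<le> (\<Sum>e<d. M)"
    by (intro sum_mono order_trans[OF card_image_le[OF finV] cV]) auto
  finally show ?thesis using cF cQ unfolding A_def by simp
qed

text \<open>Solutions with \<open>k < l\<close> are mirrored into solutions for \<open>b\<close>,
  \<open>a\<close> and \<open>- c\<close>, so the half count applies twice. The sum
  \<open>a + b\<close> in the condition on \<open>d\<close> serves both orders.\<close>

lemma dioph_L_stage_le:
  fixes n :: "nat \<Rightarrow> nat" and a b d P N M D :: nat
  assumes gap: "\<And>k. k \<ge> 1 \<Longrightarrow> 2 * n k < n (Suc k)"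
    and n: "\<And>k. k \<in> {P<..N} \<Longrightarrow> n k = D * 3 ^ k + k div M"
    and M: "M \<ge> 1" "d \<le> M" and D: "(a + b) * (N div M) < D" and ab: "a \<ge> 1" "b \<ge> 1"
    and d: "2 * (a + b) \<le> 2 ^ d"
  shows "dioph_L n N a b \<le> 2 * (1 + P + d * M)"
  unfolding dioph_L_def
proof (rule cSUP_least)
  show "{c::int. a = b \<longrightarrow> c \<noteq> 0} \<noteq> {}" by (auto intro: exI[of _ 1])
  fix c :: int assume "c \<in> {c. a = b \<longrightarrow> c \<noteq> 0}"
  then have c: "a = b \<Longrightarrow> c \<noteq> 0" "b = a \<Longrightarrow> - c \<noteq> 0" by auto
  let ?H = "\<lambda>a b c. {(k, l). k \<in> {1..N} \<and> l \<in> {1..N} \<and> l \<le> k \<and> int a * int (n k) - int b * int (n l) = c}"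
  have fin: "finite (?H a b c)" for a b c
    by (rule finite_subset[of _ "{1..N} \<times> {1..N}"]) auto
  have "{(k, l). k \<in> {1..N} \<and> l \<in> {1..N} \<and> int a * int (n k) - int b * int (n l) = c}
      \<subseteq> ?H a b c \<union> prod.swap ` ?H b a (- c)"
  proof
    fix p assume p: "p \<in> {(k, l). k \<in> {1..N} \<and> l \<in> {1..N} \<and> int a * int (n k) - int b * int (n l) = c}"
    obtain k l where kl: "p = (k, l)" by (cases p)
    show "p \<in> ?H a b c \<union> prod.swap ` ?H b a (- c)"
    proof (cases "l \<le> k")
      case True
      then show ?thesis using p kl by simp
    next
      case False
      then have "(l, k) \<in> ?H b a (- c)" using p kl by auto
      then have "prod.swap (l, k) \<in> prod.swap ` ?H b a (- c)" by (rule imageI)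
      then show ?thesis by (simp add: kl)
    qed
  qed
  then have "card {(k, l). k \<in> {1..N} \<and> l \<in> {1..N} \<and> int a * int (n k) - int b * int (n l) = c}
      \<le> card (?H a b c \<union> prod.swap ` ?H b a (- c))"
    using fin by (intro card_mono) auto
  also have "\<dots> \<le> card (?H a b c) + card (?H b a (- c))"
    by (rule order_trans[OF card_Un_le add_left_mono[OF card_image_le[OF fin]]])
  also have "\<dots> \<le> (1 + P + d * M) + (1 + P + d * M)"
  proof (rule add_mono)
    show "card (?H a b c) \<le> 1 + P + d * M"
      using d by (intro card_dioph_half[OF gap n M D ab _ c(1)]) auto
    show "card (?H b a (- c)) \<le> 1 + P + d * M"
      using d D by (intro card_dioph_half[OF gap n M _ ab(2,1) _ c(2)]) (auto simp: add.commute)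
  qed
  finally show "card {(k, l). k \<in> {1..N} \<and> l \<in> {1..N} \<and> int a * int (n k) - int b * int (n l) = c}
      \<le> 2 * (1 + P + d * M)" by simp
qed

section \<open>The staged construction\<close>

text \<open>\<open>Q P N\<close> means that a stage may run from \<open>P\<close> to
  \<open>N\<close>. Dependent choice yields the stage ends \<open>r s\<close>, and each
  \<open>k\<close> takes its parameters from the first stage end at or beyond it; monotonicity of
  \<open>D\<close> preserves the growth across stages.\<close>

lemma staged_sequence_exists:
  fixes D M :: "nat \<Rightarrow> nat" and Q :: "nat \<Rightarrow> nat \<Rightarrow> bool"
  assumes ex: "\<And>P. \<exists>N. Q P N"
    and Q: "\<And>P N. Q P N \<Longrightarrow> P < N \<and> D P \<le> D N \<and> 1 \<le> D N \<and> N div M N \<le> D N"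
  obtains n :: "nat \<Rightarrow> nat" and \<N> :: "nat set" where
    "\<And>k. k \<ge> 1 \<Longrightarrow> n k > 0" "\<And>k. k \<ge> 1 \<Longrightarrow> 9 * n k \<le> 4 * n (Suc k)"
    "infinite \<N>"
    "\<And>N. N \<in> \<N> \<Longrightarrow> \<exists>P. Q P N \<and> (\<forall>k\<in>{P<..N}. n k = D N * 3 ^ k + k div M N)"
proof -
  have "\<exists>r. \<forall>s. (s = 0 \<longrightarrow> r s = (0::nat)) \<and> Q (r s) (r (Suc s))"
    using ex by (intro dependent_nat_choice) auto
  then obtain r where r0: "r 0 = 0" and r: "\<And>s. Q (r s) (r (Suc s))" by blast
  have r_mono: "strict_mono r" unfolding strict_mono_Suc_iff using Q[OF r] by blast
  have Dr: "D (r s) \<le> D (r s')" if "s \<le> s'" for s s'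
    using lift_Suc_mono_le[of "\<lambda>s. D (r s)"] Q[OF r] that by blast
  define \<sigma> where "\<sigma> k = (LEAST s. k \<le> r s)" for k
  have \<sigma>: "k \<le> r (\<sigma> k)" for k
    unfolding \<sigma>_def by (rule LeastI[of _ k]) (rule seq_suble[OF r_mono])
  have \<sigma>_le: "\<sigma> k \<le> s" if "k \<le> r s" for k s
    unfolding \<sigma>_def using that by (rule Least_le)
  have \<sigma>_pos: "\<sigma> k \<ge> 1" if "k \<ge> 1" for k
    using \<sigma>[of k] that r0 by (cases "\<sigma> k") auto
  define n where "n k = D (r (\<sigma> k)) * 3 ^ k + k div M (r (\<sigma> k))" for k
  have D1: "1 \<le> D (r (\<sigma> k))" "k div M (r (\<sigma> k)) \<le> D (r (\<sigma> k))" if k: "k \<ge> 1" for k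
  proof -
    obtain s where s: "\<sigma> k = Suc s" using \<sigma>_pos[OF k] by (cases "\<sigma> k") auto
    have "k div M (r (\<sigma> k)) \<le> r (\<sigma> k) div M (r (\<sigma> k))" by (rule div_le_mono[OF \<sigma>])
    with Q[OF r, of s] show "1 \<le> D (r (\<sigma> k))" "k div M (r (\<sigma> k)) \<le> D (r (\<sigma> k))"
      unfolding s by auto
  qed
  show ?thesis
  proof
    show "n k > 0" if "k \<ge> 1" for k using D1[OF that] by (simp add: n_def)
    show "9 * n k \<le> 4 * n (Suc k)" if k: "k \<ge> 1" for k
    proof -
      have "D (r (\<sigma> k)) \<le> D (r (\<sigma> (Suc k)))"
        by (intro Dr \<sigma>_le) (use \<sigma>[of "Suc k"] in linarith)
      then have 1: "D (r (\<sigma> k)) * 3 ^ k \<le> D (r (\<sigma> (Suc k))) * 3 ^ k" by (rule mult_right_mono) simp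
      \<comment> \<open>Since \<open>3 ^ k \<ge> 3\<close>, the shift adds at most a third of the
        main term, which lowers the ratio 3 to no less than 9/4.\<close>
      have "(3::nat) ^ 1 \<le> 3 ^ k" using k by (intro power_increasing) auto
      then have "k div M (r (\<sigma> k)) * 3 \<le> D (r (\<sigma> k)) * 3 ^ k"
        using D1(2)[OF k] by (intro mult_mono) auto
      moreover have "9 * (x + q) \<le> 12 * x" if "q * 3 \<le> x" for q x :: nat using that by simp
      ultimately have "9 * n k \<le> 12 * (D (r (\<sigma> k)) * 3 ^ k)" unfolding n_def by blast
      also have "\<dots> \<le> 12 * (D (r (\<sigma> (Suc k))) * 3 ^ k)" using 1 by (rule mult_left_mono) simp
      also have "\<dots> \<le> 4 * n (Suc k)" by (simp add: n_def)
      finally show ?thesis .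
    qed
    show "infinite (range (\<lambda>s. r (Suc s)))"
      by (rule range_inj_infinite) (use r_mono in \<open>auto simp: inj_def strict_mono_eq\<close>)
    fix N assume "N \<in> range (\<lambda>s. r (Suc s))"
    then obtain s where N: "N = r (Suc s)" by auto
    have "n k = D N * 3 ^ k + k div M N" if "k \<in> {r s<..N}" for k
    proof -
      have "\<sigma> k \<le> Suc s" using that N by (intro \<sigma>_le) auto
      moreover have "\<not> \<sigma> k \<le> s"
      proof
        assume "\<sigma> k \<le> s"
        then have "r (\<sigma> k) \<le> r s" using r_mono by (simp add: strict_mono_less_eq)
        with \<sigma>[of k] that show False by simp
      qed
      ultimately have "\<sigma> k = Suc s" by simp
      then show ?thesis by (simp add: n_def N)
    qed
    then show "\<exists>P. Q P N \<and> (\<forall>k\<in>{P<..N}. n k = D N * 3 ^ k + k div M N)"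
      using r[of s] N by blast
  qed
qed

text \<open>With \<open>L = ln \<gamma>\<close>, tilting costs a factor
  \<open>exp (- \<epsilon> * L)\<close> and the restriction to a short interval a factor of order
  \<open>exp (- L)\<close>. Against the Gaussian exponent this leaves \<open>(1 +
  \<epsilon>)\<^sup>2 - 1 - \<epsilon> = \<epsilon> + \<epsilon>\<^sup>2\<close> times
  \<open>L\<close>.\<close>

lemma stage_ratio_ge:
  fixes n :: "nat \<Rightarrow> nat" and K N P M G D :: nat and \<gamma> \<epsilon> :: real
  assumes \<epsilon>: "\<epsilon> > 0" and K: "real K \<ge> 1024 * (1 + \<epsilon>)\<^sup>2 / \<epsilon>"
    and \<gamma>: "\<gamma> > 0" and L: "ln \<gamma> \<ge> 9 * K" "\<epsilon> * ln \<gamma> \<ge> 36"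
    and N\<gamma>: "N / \<gamma> \<ge> 1024 * (1 + \<epsilon>)\<^sup>2" and M: "M = nat \<lfloor>N / \<gamma>\<rfloor>"
    and P: "P * P \<le> N" "2 * (P + K) \<le> N"
    and G: "G = 6 * 3 ^ K * (N div M + 1)" and D: "D = G * N"
    and n: "\<And>k. k \<in> {P<..N} \<Longrightarrow> n k = D * 3 ^ k + k div M"
  shows "exp (\<epsilon> * ln \<gamma>) / (36 * 3 ^ K) \<le>
    measure lborel {x \<in> {0..1}. lac_sum (triadic_poly K) n N x
        \<ge> (1 + \<epsilon>) * L2_norm_unit (triadic_poly K) * sqrt (2 * real N * ln \<gamma>)}
      / (1 - std_normal_cdf ((1 + \<epsilon>) * sqrt (2 * ln \<gamma>)))"
proof -
  define L where "L = ln \<gamma>"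
  define w where "w = sqrt (K * N * L)"
  \<comment> \<open>With this tilt \<open>a * K * N / 8\<close>, a lower bound for the tilted mean,
    is \<open>4 * (1 + \<epsilon>) * w\<close>, twice the bound for \<open>t\<close>. Its cost
    \<open>a\<^sup>2 * N\<close> is at most \<open>\<epsilon> * L\<close> by the size of
    \<open>K\<close>.\<close>
  define a where "a = 32 * (1 + \<epsilon>) * w / (K * N)"
  define t where "t = (1 + \<epsilon>) * L2_norm_unit (triadic_poly K) * sqrt (2 * real N * L)"
  have "0 < 1024 * (1 + \<epsilon>)\<^sup>2 / \<epsilon>" using \<epsilon> by simp
  then have K0: "real K > 0" using K by linarith
  then have K1: "K \<ge> 1" "real K \<ge> 1" by simp_all
  have L0: "L \<ge> 9 * K" "L \<ge> 9" "\<epsilon> * L \<ge> 36" using L K1 by (simp_all add: L_def)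
  then have expL: "\<gamma> = exp L" using \<gamma> by (simp add: L_def)
  have N1: "N \<ge> 1" using P(2) K1(1) by simp
  have \<gamma>1: "\<gamma> \<ge> 1" "L \<le> \<gamma>" using L0 exp_ge_add_one_self[of L] unfolding expL by linarith+
  have w0: "w \<ge> 0" and w2: "w\<^sup>2 = K * N * L" using L0 by (simp_all add: w_def)
  have sN: "(sqrt N)\<^sup>2 = N" "sqrt N \<ge> 1" using N1 by simp_all
  have a0: "a \<ge> 0" using w0 \<epsilon> by (simp add: a_def)
  have a2: "a\<^sup>2 * N = 1024 * (1 + \<epsilon>)\<^sup>2 / K * L"
    using K0 N1 unfolding a_def power_divide power_mult_distrib w2
    by (simp add: field_simps power2_eq_square)
  have "1024 * (1 + \<epsilon>)\<^sup>2 \<le> \<epsilon> * K" using K \<epsilon> by (simp add: field_simps)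
  then have "1024 * (1 + \<epsilon>)\<^sup>2 / K \<le> \<epsilon>" using K0 by (simp add: field_simps)
  then have "1024 * (1 + \<epsilon>)\<^sup>2 / K * L \<le> \<epsilon> * L" using L0 by (intro mult_right_mono) auto
  then have a2_le: "a\<^sup>2 * N \<le> \<epsilon> * L" by (simp add: a2)
  have a1: "a \<le> 1"
  proof -
    have "1024 * (1 + \<epsilon>)\<^sup>2 * L \<le> 1024 * (1 + \<epsilon>)\<^sup>2 * \<gamma>" using \<gamma>1 by (intro mult_left_mono) auto
    also have "\<dots> \<le> N" using N\<gamma> \<gamma> by (simp add: field_simps)
    finally have "1024 * (1 + \<epsilon>)\<^sup>2 * L \<le> N" .
    moreover have "1024 * (1 + \<epsilon>)\<^sup>2 * L = a\<^sup>2 * N * K" using K0 by (simp add: a2)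
    moreover have "a\<^sup>2 * N * 1 \<le> a\<^sup>2 * N * K" using K1 by (intro mult_left_mono) auto
    ultimately have "a\<^sup>2 * N \<le> 1 * N" by linarith
    then have "a\<^sup>2 \<le> 1\<^sup>2" using N1 by simp
    then show ?thesis by (rule power2_le_imp_le) simp
  qed
  \<comment> \<open>From \<open>\<epsilon> * L \<ge> 36\<close> follows
    \<open>sqrt (\<epsilon> * L) \<le> \<epsilon> * L / 6\<close>, so each of the two summands takes
    at most half of \<open>\<epsilon> * L\<close>.\<close>
  have expo: "a * (a / 2 * N + 3 * sqrt N) \<le> \<epsilon> * L"
  proof -
    have "(a * sqrt N)\<^sup>2 \<le> \<epsilon> * L" using a2_le sN by (simp add: power_mult_distrib)
    also have "\<dots> \<le> \<epsilon> * L * (\<epsilon> * L / 36)" using L0 by (intro mult_le_cancel_left1[THEN iffD2]) auto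
    also have "\<dots> = (\<epsilon> * L / 6)\<^sup>2" by (simp add: power2_eq_square)
    finally have "a * sqrt N \<le> \<epsilon> * L / 6" by (rule power2_le_imp_le) (use L0 in simp)
    moreover have "a * (a / 2 * N + 3 * sqrt N) = a\<^sup>2 * N / 2 + 3 * (a * sqrt N)"
      by (simp add: power2_eq_square algebra_simps)
    ultimately show ?thesis using a2_le by linarith
  qed
  have "t \<le> (1 + \<epsilon>) * sqrt (2 * K) * sqrt (2 * real N * L)"
    unfolding t_def using \<epsilon> L2_norm_triadic_poly_le[of K] L0
    by (intro mult_right_mono mult_left_mono) auto
  also have "\<dots> = (1 + \<epsilon>) * sqrt (4 * (K * N * L))"
    by (simp add: mult.assoc flip: real_sqrt_mult)
  also have "\<dots> = 2 * (1 + \<epsilon>) * w" unfolding w_def by (subst real_sqrt_mult) simp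
  finally have t_le: "t \<le> 2 * (1 + \<epsilon>) * w" .
  have w_ge: "3 * K * sqrt N \<le> w"
  proof (rule power2_le_imp_le)
    have "real (K * N) * real (9 * K) \<le> real (K * N) * L" using L0 by (intro mult_left_mono) auto
    then show "(3 * K * sqrt N)\<^sup>2 \<le> w\<^sup>2"
      unfolding w2 power_mult_distrib sN(1) by (simp add: power2_eq_square algebra_simps)
  qed (rule w0)
  \<comment> \<open>Of \<open>4 * (1 + \<epsilon>) * w\<close>, one \<open>w\<close> pays for the
    Chebyshev deviation and one for the initial terms and the drift.\<close>
  have t: "t \<le> a / 4 * (K * (real N - P - K)) - 3 * K * sqrt N - K * P - 2 * K"
  proof -
    have "real (2 * (P + K)) \<le> real N" using P(2) by (simp only: of_nat_le_iff)
    then have "real N / 2 \<le> real N - P - K" by simp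
    then have "a / 4 * (K * (real N / 2)) \<le> a / 4 * (K * (real N - P - K))"
      using a0 by (intro mult_left_mono) auto
    moreover have "a / 4 * (K * (real N / 2)) = 4 * (1 + \<epsilon>) * w"
      using K0 N1 by (simp add: a_def)
    moreover have "K * P + 2 * K \<le> 3 * K * sqrt N"
    proof -
      have "real (P * P) \<le> real N" using P(1) by (simp only: of_nat_le_iff)
      then have "real P \<le> sqrt N" by (intro real_le_rsqrt) (simp add: power2_eq_square)
      then have "real P + 2 \<le> 3 * sqrt N" using sN(2) by linarith
      then have "real K * (real P + 2) \<le> real K * (3 * sqrt N)" by (rule mult_left_mono) simp
      then show ?thesis by (simp add: algebra_simps)
    qed
    moreover have "1 * w \<le> (1 + \<epsilon>) * w" using w0 \<epsilon> by (intro mult_right_mono) auto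
    ultimately show ?thesis using t_le w_ge by linarith
  qed
  have tail: "1 / 2 * exp (- a * (a / 2 * N + 3 * sqrt N)) / G
      \<le> measure lborel {x \<in> {0..1}. t \<le> lac_sum (triadic_poly K) n N x}"
    by (rule lac_sum_triadic_tail[OF N1 K1(1) _ G D n _ a0 a1 t]) (use P in \<open>auto intro: div_le_mono\<close>)
  \<comment> \<open>Rounding \<open>N / \<gamma>\<close> down at most halves it, so
    \<open>N div M \<le> 2 * \<gamma>\<close>; the added 1 is at most
    \<open>\<gamma>\<close>.\<close>
  have "real G \<le> 18 * 3 ^ K * \<gamma>"
  proof -
    have "(1::real) \<le> 1024 * (1 + \<epsilon>)\<^sup>2" using \<epsilon> by (simp add: power2_eq_square algebra_simps)
    then have N\<gamma>1: "N / \<gamma> \<ge> 1" using N\<gamma> by linarith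
    then have "1 \<le> \<lfloor>N / \<gamma>\<rfloor>" by simp
    then have "real M = of_int \<lfloor>N / \<gamma>\<rfloor>" "real M \<ge> 1" by (simp_all add: M)
    then have M1: "real M \<ge> 1" and "real M \<ge> N / \<gamma> - 1" by linarith+
    then have "N / \<gamma> \<le> 2 * real M" by linarith
    then have "N / real M \<le> 2 * \<gamma>" using M1 \<gamma> by (simp add: field_simps)
    moreover have "real (N div M) \<le> N / real M" by (rule of_nat_div_le_of_nat)
    ultimately have "real (N div M + 1) \<le> 3 * \<gamma>" using \<gamma>1 by simp
    then have "6 * 3 ^ K * real (N div M + 1) \<le> 6 * 3 ^ K * (3 * \<gamma>)" by (rule mult_left_mono) simp
    also have "\<dots> = 18 * 3 ^ K * \<gamma>" by simp
    also have "6 * 3 ^ K * real (N div M + 1) = real G"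
      by (simp only: G of_nat_mult of_nat_power of_nat_numeral)
    finally show ?thesis .
  qed
  moreover have "0 < real G" unfolding G of_nat_0_less_iff by (intro mult_pos_pos) auto
  ultimately have "1 / 2 * exp (- (\<epsilon> * L)) / (18 * 3 ^ K * \<gamma>) \<le> 1 / 2 * exp (- a * (a / 2 * N + 3 * sqrt N)) / G"
    using expo by (intro frac_le mult_left_mono) auto
  also note tail
  finally have num: "1 / 2 * exp (- (\<epsilon> * L)) / (18 * 3 ^ K * exp L)
      \<le> measure lborel {x \<in> {0..1}. t \<le> lac_sum (triadic_poly K) n N x}" by (simp add: expL)
  define q where "q = 1 - std_normal_cdf ((1 + \<epsilon>) * sqrt (2 * L))"
  have q: "0 < q" "q \<le> exp (- ((1 + \<epsilon>)\<^sup>2 * L))"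
  proof -
    have "0 \<le> (1 + \<epsilon>) * sqrt (2 * L)" using \<epsilon> L0 by simp
    note * = std_normal_upper_tail[OF this]
    show "0 < q" using *(1) by (simp add: q_def)
    have "- ((1 + \<epsilon>) * sqrt (2 * L))\<^sup>2 / 2 = - ((1 + \<epsilon>)\<^sup>2 * L)"
      using L0 by (simp add: power_mult_distrib)
    then show "q \<le> exp (- ((1 + \<epsilon>)\<^sup>2 * L))" using *(2) by (simp add: q_def)
  qed
  have "exp (\<epsilon> * L) / (36 * 3 ^ K) \<le> exp (\<epsilon> * L + \<epsilon>\<^sup>2 * L) / (36 * 3 ^ K)"
    using L0 by (intro divide_right_mono) auto
  also have "\<epsilon> * L + \<epsilon>\<^sup>2 * L = - (\<epsilon> * L) - L + (1 + \<epsilon>)\<^sup>2 * L"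
    by (simp add: power2_eq_square algebra_simps)
  also have "exp (- (\<epsilon> * L) - L + (1 + \<epsilon>)\<^sup>2 * L) / (36 * 3 ^ K)
      = 1 / 2 * exp (- (\<epsilon> * L)) / (18 * 3 ^ K * exp L) / exp (- ((1 + \<epsilon>)\<^sup>2 * L))"
    by (simp add: exp_add exp_diff exp_minus field_simps)
  also have "\<dots> \<le> measure lborel {x \<in> {0..1}. t \<le> lac_sum (triadic_poly K) n N x} / q"
    using q num by (intro frac_le) auto
  finally show ?thesis unfolding t_def q_def L_def .
qed

section \<open>Choice of the stages and assembly of the construction\<close>

theorem theoremB:
  fixes g :: "nat \<Rightarrow> real" and \<epsilon> :: real
  assumes g_pos: "\<And>N. N \<ge> 1 \<Longrightarrow> g N > 0"
    and g_mono: "mono_on {1..} g"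
    and quot_mono: "mono_on {1..} (\<lambda>N. real N / g N)"
    and g_lim: "filterlim g at_top sequentially"
    and quot_lim: "filterlim (\<lambda>N. real N / g N) at_top sequentially"
    and eps: "\<epsilon> > 0"
  shows "\<exists>(n :: nat \<Rightarrow> nat) (f :: real \<Rightarrow> real) (\<N> :: nat set).
      (\<forall>k\<ge>1. n k > 0) \<and> hadamard_gap n \<and>
      mean_zero_trig_poly f \<and> f \<noteq> (\<lambda>x. 0) \<and>
      \<N> \<subseteq> {1..} \<and> infinite \<N> \<and>
      (\<forall>a\<ge>1. \<forall>b\<ge>1. \<exists>C::real. \<forall>N\<in>\<N>. real (dioph_L n N a b) \<le> C * (real N / g N)) \<and>
      Limsup (inf sequentially (principal \<N>))
        (\<lambda>N. ereal
          (measure lborel {x \<in> {0..1}.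
              lac_sum f n N x \<ge> (1 + \<epsilon>) * L2_norm_unit f * sqrt (2 * real N * ln (g N))}
           / (1 - std_normal_cdf ((1 + \<epsilon>) * sqrt (2 * ln (g N)))))) = \<infinity>"
proof -
  define K where "K = nat \<lceil>1024 * (1 + \<epsilon>)\<^sup>2 / \<epsilon>\<rceil>"
  have K: "real K \<ge> 1024 * (1 + \<epsilon>)\<^sup>2 / \<epsilon>" unfolding K_def by (rule real_nat_ceiling_ge)
  have "0 < 1024 * (1 + \<epsilon>)\<^sup>2 / \<epsilon>" using eps by simp
  then have K1: "K \<ge> 1" using K by (cases K) auto
  define M where "M N = nat \<lfloor>real N / g N\<rfloor>" for N
  define G where "G N = 6 * 3 ^ K * (N div M N + 1)" for N
  define D where "D N = G N * N" for N
  \<comment> \<open>\<open>D P \<le> N\<close> makes \<open>D\<close> increase along the stages, and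
    \<open>real P \<le> real N / g N\<close> bounds the share of earlier stages in the count. The
    clauses from \<open>P * P \<le> N\<close> on feed \<open>stage_ratio_ge\<close>.\<close>
  define Q where "Q P N \<longleftrightarrow> P < N \<and> D P \<le> N \<and> real P \<le> real N / g N \<and> P * P \<le> N \<and> 2 * (P + K) \<le> N
    \<and> 9 * real K \<le> ln (g N) \<and> 36 / \<epsilon> \<le> ln (g N) \<and> 1024 * (1 + \<epsilon>)\<^sup>2 \<le> real N / g N" for P N
  have G_ge: "N div M N + 1 \<le> G N" for N
  proof -
    have "1 * (N div M N + 1) \<le> 6 * 3 ^ K * (N div M N + 1)" by (intro mult_right_mono) auto
    then show ?thesis by (simp add: G_def)
  qed
  have D_ge: "N \<le> D N" "N \<ge> 1 \<Longrightarrow> N div M N + 1 \<le> D N" for N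
  proof -
    have "1 * N \<le> G N * N" using G_ge[of N] by (intro mult_right_mono) auto
    then show "N \<le> D N" by (simp add: D_def)
    assume "N \<ge> 1"
    then have "G N * 1 \<le> D N" unfolding D_def by (intro mult_left_mono) auto
    then show "N div M N + 1 \<le> D N" using G_ge[of N] by linarith
  qed
  have lng: "filterlim (\<lambda>N. ln (g N)) at_top sequentially"
    by (rule filterlim_compose[OF ln_at_top g_lim])
  have exQ: "\<exists>N. Q P N" for P
  proof -
    \<comment> \<open>For fixed \<open>P\<close> each clause holds for all large \<open>N\<close>,
      since \<open>N / g N\<close> and \<open>ln (g N)\<close> diverge.\<close>
    have "eventually (Q P) sequentially"
      unfolding Q_def
      by (intro eventually_conj eventually_gt_at_top eventually_ge_at_top
          filterlim_at_top[THEN iffD1, rule_format, OF quot_lim]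
          filterlim_at_top[THEN iffD1, rule_format, OF lng])
    then show ?thesis using eventually_happens'[OF sequentially_bot] by blast
  qed
  have QD: "P < N \<and> D P \<le> D N \<and> 1 \<le> D N \<and> N div M N \<le> D N" if "Q P N" for P N
    using that D_ge[of N] by (auto simp: Q_def)
  obtain n \<N> where n_pos: "\<And>k. k \<ge> 1 \<Longrightarrow> n k > 0"
    and n_gap: "\<And>k. k \<ge> 1 \<Longrightarrow> 9 * n k \<le> 4 * n (Suc k)" and inf: "infinite \<N>"
    and stage: "\<And>N. N \<in> \<N> \<Longrightarrow> \<exists>P. Q P N \<and> (\<forall>k\<in>{P<..N}. n k = D N * 3 ^ k + k div M N)"
    using staged_sequence_exists[where Q = Q and D = D and M = M, OF exQ QD] by metis
  have N1: "N \<ge> 1" if "N \<in> \<N>" for N using stage[OF that] by (auto simp: Q_def)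
  have quot_ge1: "real N / g N \<ge> 1" if "N \<in> \<N>" for N
  proof -
    have "(1::real) \<le> 1024 * (1 + \<epsilon>)\<^sup>2" using eps by (simp add: power2_eq_square algebra_simps)
    then show ?thesis using stage[OF that] by (auto simp: Q_def)
  qed
  have gap2: "2 * n k < n (Suc k)" if "k \<ge> 1" for k
    using n_gap[OF that] n_pos[OF that] by linarith
  have "hadamard_gap n"
    unfolding hadamard_gap_def
  proof (intro exI[of _ "9 / 4"] conjI allI impI)
    fix k :: nat assume k: "1 \<le> k"
    have "9 * real (n k) \<le> 4 * real (n (Suc k))" using n_gap[OF k] by linarith
    then show "9 / 4 \<le> real (n (Suc k)) / real (n k)" using n_pos[OF k] by (simp add: field_simps)
  qed simp
  moreover have "triadic_poly K \<noteq> (\<lambda>x. 0)"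
  proof
    assume "triadic_poly K = (\<lambda>x. 0)"
    then have "triadic_poly K 0 = 0" by simp
    then show False using K1 by (simp add: triadic_poly_def)
  qed
  moreover have "\<exists>C::real. \<forall>N\<in>\<N>. real (dioph_L n N a b) \<le> C * (real N / g N)"
    if ab: "a \<ge> 1" "b \<ge> 1" for a b
  proof -
    define d where "d = 2 * (a + b)"
    obtain N0 where N0: "\<And>N. N \<ge> N0 \<Longrightarrow> real d \<le> real N / g N"
      using filterlim_at_top[THEN iffD1, rule_format, OF quot_lim, of "real d"]
      unfolding eventually_sequentially by blast
    \<comment> \<open>Absorbs the finitely many \<open>N\<close> where \<open>d \<le> M N\<close> or
      \<open>a + b \<le> N\<close> may fail; this works because \<open>N / g N \<ge> 1\<close> on
      \<open>\<N>\<close>.\<close>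
    define S where "S = (\<Sum>N<N0 + a + b. real (dioph_L n N a b))"
    have S0: "S \<ge> 0" unfolding S_def by (intro sum_nonneg) simp
    have "real (dioph_L n N a b) \<le> (S + 2 * (2 + d)) * (real N / g N)" if N: "N \<in> \<N>" for N
    proof (cases "N < N0 + a + b")
      case True
      have "real (dioph_L n N a b) \<le> S"
        unfolding S_def using True by (intro member_le_sum) auto
      also have "\<dots> \<le> (S + 2 * (2 + d)) * 1" by simp
      also have "\<dots> \<le> (S + 2 * (2 + d)) * (real N / g N)"
        using quot_ge1[OF N] S0 by (intro mult_left_mono) auto
      finally show ?thesis .
    next
      case False
      obtain P where P: "Q P N" and n: "\<forall>k\<in>{P<..N}. n k = D N * 3 ^ k + k div M N"
        using stage[OF N] by blast
      have M: "d \<le> M N" unfolding M_def using N0[of N] False by (simp add: le_nat_floor)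
      \<comment> \<open>The factor \<open>N\<close> of \<open>D N\<close> dominates the constant
        \<open>a + b\<close>.\<close>
      have "(a + b) * (N div M N) < (N div M N + 1) * N"
        using False N1[OF N] by (intro le_less_trans[OF mult_right_mono[of "a + b" N]]) auto
      also have "\<dots> \<le> D N" unfolding D_def using G_ge[of N] by (intro mult_right_mono) auto
      finally have "dioph_L n N a b \<le> 2 * (1 + P + d * M N)"
        using gap2 n M ab
        by (intro dioph_L_stage_le[where D = "D N"]) (auto simp: d_def intro: less_imp_le[OF less_exp] less_le_trans)
      then have "real (dioph_L n N a b) \<le> real (2 * (1 + P + d * M N))" by (simp only: of_nat_le_iff)
      also have "\<dots> = 2 * (1 + real P + d * real (M N))" by simp
      also have "\<dots> \<le> 2 * (real N / g N + real N / g N + d * (real N / g N))"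
        using quot_ge1[OF N] P unfolding M_def Q_def
        by (intro mult_left_mono add_mono) (auto simp: of_nat_floor)
      also have "\<dots> = 2 * (2 + d) * (real N / g N)" by (simp add: algebra_simps)
      also have "\<dots> \<le> (S + 2 * (2 + d)) * (real N / g N)"
        using S0 quot_ge1[OF N] by (intro mult_right_mono) auto
      finally show ?thesis .
    qed
    then show ?thesis by blast
  qed
  moreover have "Limsup (inf sequentially (principal \<N>))
      (\<lambda>N. ereal (measure lborel {x \<in> {0..1}. lac_sum (triadic_poly K) n N x
          \<ge> (1 + \<epsilon>) * L2_norm_unit (triadic_poly K) * sqrt (2 * real N * ln (g N))}
        / (1 - std_normal_cdf ((1 + \<epsilon>) * sqrt (2 * ln (g N)))))) = \<infinity>"
    (is "Limsup ?F (\<lambda>N. ereal (?ratio N)) = \<infinity>")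
  proof (rule lim_imp_Limsup)
    \<comment> \<open>Infinitude of \<open>\<N>\<close> makes the filter proper, so a limit along it
      is also the limit superior.\<close>
    have "\<not> eventually (\<lambda>N. N \<notin> \<N>) sequentially"
      using inf by (simp add: infinite_nat_iff_unbounded_le eventually_sequentially)
    then show "?F \<noteq> bot"
      by (simp add: trivial_limit_def eventually_inf_principal)
    have "filterlim (\<lambda>N. \<epsilon> * ln (g N)) at_top sequentially"
      using eps by (intro filterlim_tendsto_pos_mult_at_top[OF tendsto_const _ lng])
    then have "filterlim (\<lambda>N. exp (\<epsilon> * ln (g N))) at_top sequentially"
      by (rule filterlim_compose[OF exp_at_top])
    then have "filterlim (\<lambda>N. 1 / (36 * 3 ^ K) * exp (\<epsilon> * ln (g N))) at_top sequentially"
      by (intro filterlim_tendsto_pos_mult_at_top[OF tendsto_const]) auto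
    then have "filterlim (\<lambda>N. 1 / (36 * 3 ^ K) * exp (\<epsilon> * ln (g N))) at_top ?F"
      by (rule filterlim_mono) auto
    moreover have "eventually (\<lambda>N. 1 / (36 * 3 ^ K) * exp (\<epsilon> * ln (g N)) \<le> ?ratio N) ?F"
      unfolding eventually_inf_principal
    proof (intro always_eventually allI impI)
      fix N assume N: "N \<in> \<N>"
      obtain P where P: "Q P N" and n: "\<forall>k\<in>{P<..N}. n k = D N * 3 ^ k + k div M N"
        using stage[OF N] by blast
      have "exp (\<epsilon> * ln (g N)) / (36 * 3 ^ K) \<le> ?ratio N"
        by (rule stage_ratio_ge[OF eps K, where P = P and M = "M N" and G = "G N" and D = "D N"])
          (use P n g_pos N1[OF N] eps in \<open>auto simp: Q_def M_def G_def D_def field_simps\<close>)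
      then show "1 / (36 * 3 ^ K) * exp (\<epsilon> * ln (g N)) \<le> ?ratio N" by simp
    qed
    ultimately have "filterlim ?ratio at_top ?F" by (rule filterlim_at_top_mono)
    then show "((\<lambda>N. ereal (?ratio N)) \<longlongrightarrow> \<infinity>) ?F"
      by (simp add: tendsto_PInfty_eq_at_top)
  qed
  moreover have "\<N> \<subseteq> {1..}" using N1 by auto
  ultimately show ?thesis
    using n_pos inf mean_zero_triadic_poly[of K]
    by (intro exI[of _ n] exI[of _ "triadic_poly K"] exI[of _ \<N>] conjI) auto
qed

end
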